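(* Let $(\Lambda,d)$ be the category of finite paths in a hybrid graph, with degree map $d:\Lambda\to\mathbb{N}^2*\mathbb{N}$, as defined in the context. Then $(\Lambda,d)$ is an $(\mathbb{N}^2*\mathbb{N})$-graph. Moreover, given finite paths $\mu = \mu_1 \dots \mu_m$ and $\nu = \nu_1 \dots \nu_n$ with $m \le n$, we have $$\mathrm{MCE}(\mu,\nu) = \begin{cases} \{\nu\} &\text{ if } n > m,\ \mu_i = \nu_i \text{ for } i < m, \text{ and } \nu_m = \mu_m\nu_m' \text{ for some } \nu_m'\\ (\mu_1\dots\mu_{m-1})\,\mathrm{MCE}(\mu_m,\nu_m) &\text{ if } n = m \text{ and } \mu_i = \nu_i \text{ for } i < m \\ \emptyset &\text{ otherwise.}\end{cases}$$ In particular, $\Lambda$ is finitely aligned.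
   Context: A quasi-lattice ordered group $(G,P)$ is a discrete group $G$ with a subsemigroup $P$ such that $P\cap P^{-1}=\{e\}$ and, under the partial order $p\le q \Leftrightarrow p^{-1}q\in P$ on $G$, every pair $p,q\in G$ with a common upper bound in $P$ has a least common upper bound $p\vee q$ in $P$ (write $p\vee q=\infty$ if there is no common upper bound in $P$, $p\vee q<\infty$ otherwise). Here $(G,P)=(\mathbb{Z}^2*\mathbb{Z},\mathbb{N}^2*\mathbb{N})$ (free products), which is quasi-lattice ordered. A $P$-graph is a countable category $\Lambda$ (its elements are its morphisms) with a functor $d:\Lambda\to P$ satisfying the factorisation property: whenever $d(\lambda)=pq$ with $p,q\in P$ there are unique $\mu,\nu\in\Lambda$ with $\lambda=\mu\nu$, $d(\mu)=p$, $d(\nu)=q$. $\mathrm{MCE}(\mu,\nu)$ is the set of $\lambda\in\Lambda$ with $d(\mu)\vee d(\nu)<\infty$, $d(\lambda)=d(\mu)\vee d(\nu)$ and $\lambda=\mu\alpha=\nu\beta$ for some $\alpha,\beta\in\Lambda$. $\Lambda$ is finitely aligned if every $\mathrm{MCE}(\mu,\nu)$ is finite (possibly empty). For $\lambda\in\Lambda$ and $E\subset\Lambda$, $\lambda E:=\{\lambda\mu:\mu\in E,\ r(\mu)=s(\lambda)\}$. Directed graph conventions: a directed graph $E$ has vertex set $E^0$, edge set $E^1$, range and source maps $r,s$; finite paths are strings $e_1\cdots e_n$ of edges with $s(e_j)=r(e_{j+1})$; $E^*$ is the path category (including vertices as paths of length $0$). An infinite receiver is a vertex $v$ with $r^{-1}(v)\cap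 E^1$ infinite. Hybrid graph: let $D$ be the directed graph with vertices $u_0,u_1,a_0,a_1$ and edges (each written source $\to$ range) $u_0\to a_0$, $a_0\to u_1$, $u_1\to a_1$, $a_1\to u_0$, $u_0\to u_1$, $u_1\to u_0$ (one of each), two loops at $a_0$ and two loops at $a_1$. Fix countable irreducible directed graphs $E_0,E_1,F_0,F_1$ (irreducible: for any two vertices there is a directed path from one to the other), each containing at least one infinite receiver, and fix infinite receivers $v_i\in E_i^0$, $w_i\in F_i^0$ ($i=0,1$). For $i=0,1$ the cartesian product $2$-graph $E_i^*\times F_i^*$ has pointwise operations and structure maps, and degree $l(\alpha,\beta)=(l(\alpha),l(\beta))\in\mathbb{N}^2$. The hybrid graph is obtained by attaching these $2$-graphs to $D$ by identifying $u_i\in D^0$ with $(v_i,w_i)\in E_i^0\times F_i^0$. A finite path is a finite string $\mu_1\dots\mu_k$ where: each $\mu_j\in D^*\sqcup\bigsqcup_{i=0,1}(E_i^*\times F_i^* )$; $s(\mu_j)=r(\mu_{j+1})$ for $1\le j<k$; and $\mu_j\in D^*\Longleftrightarrow\mu_{j+1}\in\bigsqcup_{i=0,1}E_i^*\times F_i^*$ for $1\le j<k$. Strings are taken in reduced form: a segment $\mu_j$ is a vertex only if $k=1$, and a vertex $u_i=(v_i,w_i)$ may be regarded as belonging to either type. $r(\mu_1\dots\mu_k)=r(\mu_1)$, $s(\mu_1\dots\mu_k)=s(\mu_k)$. $\Lambda$ is the set of all finite paths, a category under concatenation (composing adjacent segments of the same type). With $l:D^*\to\mathbb{N}$ the length function,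 $d(\mu_1\dots\mu_k)\in\mathbb{N}^2*\mathbb{N}$ is the word $l(\mu_1)\cdots l(\mu_k)$. *)

theory Defs
  imports "Graph_Theory.Digraph_Component" "HOL-Library.Countable_Set" "HOL-Algebra.Elementary_Groups"
begin

section \<open>Quasi-lattice ordered groups\<close>

definition ql_le :: "('g, 'x) monoid_scheme \<Rightarrow> 'g set \<Rightarrow> 'g \<Rightarrow> 'g \<Rightarrow> bool" where
  "ql_le G P p q \<longleftrightarrow> inv\<^bsub>G\<^esub> p \<otimes>\<^bsub>G\<^esub> q \<in> P"

definition ql_ubs :: "('g, 'x) monoid_scheme \<Rightarrow> 'g set \<Rightarrow> 'g \<Rightarrow> 'g \<Rightarrow> 'g set" where
  "ql_ubs G P p q = {x \<in> P. ql_le G P p x \<and> ql_le G P q x}"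

definition ql_is_join :: "('g, 'x) monoid_scheme \<Rightarrow> 'g set \<Rightarrow> 'g \<Rightarrow> 'g \<Rightarrow> 'g \<Rightarrow> bool" where
  "ql_is_join G P p q x \<longleftrightarrow> x \<in> ql_ubs G P p q \<and> (\<forall>y \<in> ql_ubs G P p q. ql_le G P x y)"

text \<open>
  The join is only meaningful when there is a common upper bound; the informal condition
  that the join is finite is \<open>ql_ubs G P p q \<noteq> {}\<close>.
\<close>

definition ql_join :: "('g, 'x) monoid_scheme \<Rightarrow> 'g set \<Rightarrow> 'g \<Rightarrow> 'g \<Rightarrow> 'g" where
  "ql_join G P p q = (THE x. ql_is_join G P p q x)"

locale quasi_lattice_ordered = group G for G (structure) +
  fixes P :: "'a set"
  assumes P_subset: "P \<subseteq> carrier G"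
    and P_closed: "p \<in> P \<Longrightarrow> q \<in> P \<Longrightarrow> p \<otimes> q \<in> P"
    and P_inter_inv: "P \<inter> (\<lambda>p. inv p) ` P = {\<one>}"
    and join_exists: "p \<in> carrier G \<Longrightarrow> q \<in> carrier G \<Longrightarrow> ql_ubs G P p q \<noteq> {}
      \<Longrightarrow> \<exists>x. ql_is_join G P p q x"

section \<open>Free products\<close>

text \<open>
  The elements of \<open>free_product G H\<close> are the reduced words: lists of non-identity
  elements taken alternately from the two groups.
\<close>

fun fp_letter :: "('a, 'x) monoid_scheme \<Rightarrow> ('b, 'y) monoid_scheme \<Rightarrow> 'a + 'b \<Rightarrow> bool" where
  "fp_letter G H (Inl a) \<longleftrightarrow> a \<in> carrier G \<and> a \<noteq> \<one>\<^bsub>G\<^esub>"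
| "fp_letter G H (Inr b) \<longleftrightarrow> b \<in> carrier H \<and> b \<noteq> \<one>\<^bsub>H\<^esub>"

text \<open>\<open>fp_cons\<close> multiplies a reduced word on the left by a non-identity letter.\<close>

fun fp_cons :: "('a, 'x) monoid_scheme \<Rightarrow> ('b, 'y) monoid_scheme \<Rightarrow> 'a + 'b
    \<Rightarrow> ('a + 'b) list \<Rightarrow> ('a + 'b) list" where
  "fp_cons G H (Inl a) (Inl a' # u) =
     (if a \<otimes>\<^bsub>G\<^esub> a' = \<one>\<^bsub>G\<^esub> then u else Inl (a \<otimes>\<^bsub>G\<^esub> a') # u)"
| "fp_cons G H (Inr b) (Inr b' # u) =
     (if b \<otimes>\<^bsub>H\<^esub> b' = \<one>\<^bsub>H\<^esub> then u else Inr (b \<otimes>\<^bsub>H\<^esub> b') # u)"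
| "fp_cons G H x u = x # u"

definition free_product ::
  "('a, 'x) monoid_scheme \<Rightarrow> ('b, 'y) monoid_scheme \<Rightarrow> ('a + 'b) list monoid" where
  "free_product G H =
    \<lparr>carrier = {u. (\<forall>x \<in> set u. fp_letter G H x) \<and> successively (\<lambda>x y. isl x \<noteq> isl y) u},
     mult = (\<lambda>u u'. foldr (fp_cons G H) u u'),
     one = []\<rparr>"

definition fp_inl :: "('a, 'x) monoid_scheme \<Rightarrow> 'a \<Rightarrow> ('a + 'b) list" where
  "fp_inl G a = (if a = \<one>\<^bsub>G\<^esub> then [] else [Inl a])"

definition fp_inr :: "('b, 'y) monoid_scheme \<Rightarrow> 'b \<Rightarrow> ('a + 'b) list" where
  "fp_inr H b = (if b = \<one>\<^bsub>H\<^esub> then [] else [Inr b])"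

text \<open>The free product of submonoids \<open>P\<close> of \<open>G\<close> and \<open>Q\<close> of \<open>H\<close>, inside the free product of \<open>G\<close> and \<open>H\<close>.\<close>

definition fp_submonoid :: "('a, 'x) monoid_scheme \<Rightarrow> 'a set \<Rightarrow> ('b, 'y) monoid_scheme \<Rightarrow> 'b set
    \<Rightarrow> ('a + 'b) list set" where
  "fp_submonoid G P H Q = {u \<in> carrier (free_product G H). set u \<subseteq> Inl ` P \<union> Inr ` Q}"

definition Z2 :: "(int \<times> int) monoid" where
  "Z2 = integer_group \<times>\<times> integer_group"

definition Z2_free_Z :: "(int \<times> int + int) list monoid" where
  "Z2_free_Z = free_product Z2 integer_group"

definition N2_free_N :: "(int \<times> int + int) list set" where
  "N2_free_N = fp_submonoid Z2 ({0..} \<times> {0..}) integer_group {0..}"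

section \<open>Categories and \<open>P\<close>-graphs\<close>

text \<open>\<open>cmp C f g\<close> is the composite \<open>f g\<close>, which is meaningful when \<open>src C f = rng C g\<close>.\<close>

record ('o, 'm) cat =
  obj :: "'o set"
  mor :: "'m set"
  rng :: "'m \<Rightarrow> 'o"
  src :: "'m \<Rightarrow> 'o"
  idn :: "'o \<Rightarrow> 'm"
  cmp :: "'m \<Rightarrow> 'm \<Rightarrow> 'm"

locale small_category =
  fixes C :: "('o, 'm) cat"
  assumes rng_obj: "f \<in> mor C \<Longrightarrow> rng C f \<in> obj C"
    and src_obj: "f \<in> mor C \<Longrightarrow> src C f \<in> obj C"
    and idn_mor: "x \<in> obj C \<Longrightarrow> idn C x \<in> mor C"
    and rng_idn: "x \<in> obj C \<Longrightarrow> rng C (idn C x) = x"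
    and src_idn: "x \<in> obj C \<Longrightarrow> src C (idn C x) = x"
    and cmp_mor: "f \<in> mor C \<Longrightarrow> g \<in> mor C \<Longrightarrow> src C f = rng C g \<Longrightarrow> cmp C f g \<in> mor C"
    and rng_cmp: "f \<in> mor C \<Longrightarrow> g \<in> mor C \<Longrightarrow> src C f = rng C g \<Longrightarrow> rng C (cmp C f g) = rng C f"
    and src_cmp: "f \<in> mor C \<Longrightarrow> g \<in> mor C \<Longrightarrow> src C f = rng C g \<Longrightarrow> src C (cmp C f g) = src C g"
    and idn_left: "f \<in> mor C \<Longrightarrow> cmp C (idn C (rng C f)) f = f"
    and idn_right: "f \<in> mor C \<Longrightarrow> cmp C f (idn C (src C f)) = f"
    and cmp_assoc: "f \<in> mor C \<Longrightarrow> g \<in> mor C \<Longrightarrow> h \<in> mor C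
      \<Longrightarrow> src C f = rng C g \<Longrightarrow> src C g = rng C h
      \<Longrightarrow> cmp C (cmp C f g) h = cmp C f (cmp C g h)"

locale P_graph =
  quasi_lattice_ordered G P + small_category L
  for G :: "('g, 'x) monoid_scheme" and P :: "'g set" and L :: "('o, 'm) cat" +
  fixes d :: "'m \<Rightarrow> 'g"
  assumes countable_mor: "countable (mor L)"
    and d_in_P: "f \<in> mor L \<Longrightarrow> d f \<in> P"
    and d_idn: "x \<in> obj L \<Longrightarrow> d (idn L x) = \<one>\<^bsub>G\<^esub>"
    and d_cmp: "f \<in> mor L \<Longrightarrow> g \<in> mor L \<Longrightarrow> src L f = rng L g
      \<Longrightarrow> d (cmp L f g) = d f \<otimes>\<^bsub>G\<^esub> d g"
    and factorisation: "f \<in> mor L \<Longrightarrow> p \<in> P \<Longrightarrow> q \<in> P \<Longrightarrow> d f = p \<otimes>\<^bsub>G\<^esub> q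
      \<Longrightarrow> \<exists>!(g, h). g \<in> mor L \<and> h \<in> mor L \<and> src L g = rng L h \<and>
            f = cmp L g h \<and> d g = p \<and> d h = q"

definition MCE :: "('g, 'x) monoid_scheme \<Rightarrow> 'g set \<Rightarrow> ('o, 'm) cat \<Rightarrow> ('m \<Rightarrow> 'g)
    \<Rightarrow> 'm \<Rightarrow> 'm \<Rightarrow> 'm set" where
  "MCE G P L d f g = {h \<in> mor L.
     ql_ubs G P (d f) (d g) \<noteq> {} \<and> d h = ql_join G P (d f) (d g) \<and>
     (\<exists>a \<in> mor L. \<exists>b \<in> mor L. src L f = rng L a \<and> src L g = rng L b \<and>
        h = cmp L f a \<and> h = cmp L g b)}"

definition finitely_aligned :: "('g, 'x) monoid_scheme \<Rightarrow> 'g set \<Rightarrow> ('o, 'm) cat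
    \<Rightarrow> ('m \<Rightarrow> 'g) \<Rightarrow> bool" where
  "finitely_aligned G P L d \<longleftrightarrow> (\<forall>f \<in> mor L. \<forall>g \<in> mor L. finite (MCE G P L d f g))"

definition left_mult :: "('o, 'm) cat \<Rightarrow> 'm \<Rightarrow> 'm set \<Rightarrow> 'm set" where
  "left_mult L f E = {cmp L f g | g. g \<in> E \<and> rng L g = src L f}"

section \<open>Path categories of directed graphs\<close>

text \<open>
  An edge \<open>e\<close> has source \<open>tail E e\<close> and range \<open>head E e\<close>. The path \<open>e\<^sub>1 \<dots> e\<^sub>n\<close>, with
  the source of each edge equal to the range of the next, is represented by the pair of its range
  and its list of edges, so that \<open>(x, [])\<close> is the vertex \<open>x\<close>.
\<close>

type_synonym ('v, 'e) path = "'v \<times> 'e list"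

definition path_cat :: "('v, 'e) pre_digraph \<Rightarrow> ('v, ('v, 'e) path) cat" where
  "path_cat E =
    \<lparr>obj = verts E,
     mor = {(x, es). x \<in> verts E \<and> set es \<subseteq> arcs E \<and>
              (es \<noteq> [] \<longrightarrow> head E (hd es) = x) \<and>
              (\<forall>j. Suc j < length es \<longrightarrow> tail E (es ! j) = head E (es ! Suc j))},
     rng = fst,
     src = (\<lambda>(x, es). if es = [] then x else tail E (last es)),
     idn = (\<lambda>x. (x, [])),
     cmp = (\<lambda>(x, es) (y, fs). (x, es @ fs))\<rparr>"

definition path_length :: "('v, 'e) path \<Rightarrow> nat" where
  "path_length p = length (snd p)"

definition infinite_receiver :: "('v, 'e) pre_digraph \<Rightarrow> 'v \<Rightarrow> bool" where
  "infinite_receiver E x \<longleftrightarrow> x \<in> verts E \<and> infinite (in_arcs E x)"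

definition product_cat :: "('o, 'm) cat \<Rightarrow> ('p, 'n) cat \<Rightarrow> ('o \<times> 'p, 'm \<times> 'n) cat" where
  "product_cat C D =
    \<lparr>obj = obj C \<times> obj D,
     mor = mor C \<times> mor D,
     rng = map_prod (rng C) (rng D),
     src = map_prod (src C) (src D),
     idn = map_prod (idn C) (idn D),
     cmp = (\<lambda>(f, g) (f', g'). (cmp C f f', cmp D g g'))\<rparr>"

section \<open>Hybrid graphs\<close>

datatype ix = I0 | I1

fun other_ix :: "ix \<Rightarrow> ix" where
  "other_ix I0 = I1"
| "other_ix I1 = I0"

text \<open>
  In the graph \<open>D\<close>, the vertices \<open>VU i\<close> and \<open>VA i\<close> are \<open>u\<^sub>i\<close> and \<open>a\<^sub>i\<close>, \<open>UA i\<close> is the edge from \<open>u\<^sub>i\<close> to \<open>a\<^sub>i\<close>, \<open>AU i\<close> is the edge from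
  \<open>a\<^sub>i\<close> to \<open>u\<close> with the other index, \<open>UU i\<close> is the edge from \<open>u\<^sub>i\<close> to the other \<open>u\<close>, and
  \<open>AA i b\<close> (for the two values of \<open>b\<close>) are the two loops at \<open>a\<^sub>i\<close>.
\<close>

datatype dvert = VU ix | VA ix

datatype dedge = UA ix | AU ix | UU ix | AA ix bool

fun dtail :: "dedge \<Rightarrow> dvert" where
  "dtail (UA i) = VU i"
| "dtail (AU i) = VA i"
| "dtail (UU i) = VU i"
| "dtail (AA i b) = VA i"

fun dhead :: "dedge \<Rightarrow> dvert" where
  "dhead (UA i) = VA i"
| "dhead (AU i) = VU (other_ix i)"
| "dhead (UU i) = VU (other_ix i)"
| "dhead (AA i b) = VA i"

definition Dgraph :: "(dvert, dedge) pre_digraph" where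
  "Dgraph = \<lparr>verts = UNIV, arcs = UNIV, tail = dtail, head = dhead\<rparr>"

text \<open>
  The vertices of the hybrid graph: \<open>glue\<close> maps the vertices of the \<open>i\<close>-th 2-graph to
  those of the hybrid graph, and sends \<open>(v\<^sub>i, w\<^sub>i)\<close> to \<open>u\<^sub>i\<close>, so that \<open>CV i (v i) (w i)\<close> is not
  used.
\<close>

datatype ('v, 'w) hvert = DV dvert | CV ix 'v 'w

definition glue :: "(ix \<Rightarrow> 'v) \<Rightarrow> (ix \<Rightarrow> 'w) \<Rightarrow> ix \<Rightarrow> 'v \<times> 'w \<Rightarrow> ('v, 'w) hvert" where
  "glue v w i z = (if z = (v i, w i) then DV (VU i) else CV i (fst z) (snd z))"

datatype ('v, 'e, 'w, 'f) seg =
    DS "(dvert, dedge) path"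
  | CS ix "('v, 'e) path \<times> ('w, 'f) path"

type_synonym ('v, 'e, 'w, 'f) hpath = "('v, 'e, 'w, 'f) seg list"

definition two_graph :: "(ix \<Rightarrow> ('v, 'e) pre_digraph) \<Rightarrow> (ix \<Rightarrow> ('w, 'f) pre_digraph) \<Rightarrow> ix
    \<Rightarrow> ('v \<times> 'w, ('v, 'e) path \<times> ('w, 'f) path) cat" where
  "two_graph E F i = product_cat (path_cat (E i)) (path_cat (F i))"

fun is_DS :: "('v, 'e, 'w, 'f) seg \<Rightarrow> bool" where
  "is_DS (DS p) = True"
| "is_DS (CS i z) = False"

fun seg_is_vertex :: "('v, 'e, 'w, 'f) seg \<Rightarrow> bool" where
  "seg_is_vertex (DS p) \<longleftrightarrow> path_length p = 0"
| "seg_is_vertex (CS i (a, b)) \<longleftrightarrow> path_length a = 0 \<and> path_length b = 0"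

context
  fixes E :: "ix \<Rightarrow> ('v, 'e) pre_digraph" and F :: "ix \<Rightarrow> ('w, 'f) pre_digraph"
    and v :: "ix \<Rightarrow> 'v" and w :: "ix \<Rightarrow> 'w"
begin

fun seg_rng :: "('v, 'e, 'w, 'f) seg \<Rightarrow> ('v, 'w) hvert" where
  "seg_rng (DS p) = DV (rng (path_cat Dgraph) p)"
| "seg_rng (CS i z) = glue v w i (rng (two_graph E F i) z)"

fun seg_src :: "('v, 'e, 'w, 'f) seg \<Rightarrow> ('v, 'w) hvert" where
  "seg_src (DS p) = DV (src (path_cat Dgraph) p)"
| "seg_src (CS i z) = glue v w i (src (two_graph E F i) z)"

definition segments :: "('v, 'e, 'w, 'f) seg set" where
  "segments = DS ` mor (path_cat Dgraph) \<union> (\<Union>i. CS i ` mor (two_graph E F i))"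

fun seg_cmp :: "('v, 'e, 'w, 'f) seg \<Rightarrow> ('v, 'e, 'w, 'f) seg \<Rightarrow> ('v, 'e, 'w, 'f) seg" where
  "seg_cmp (DS p) (DS q) = DS (cmp (path_cat Dgraph) p q)"
| "seg_cmp (CS i y) (CS j z) = CS i (cmp (two_graph E F i) y z)"
| "seg_cmp s t = undefined"

text \<open>
  The finite paths. The last condition chooses, between the two representations of the
  vertex \<open>u\<^sub>i = (v\<^sub>i, w\<^sub>i)\<close>, the one of type \<open>D\<close>.
\<close>

definition finite_paths :: "('v, 'e, 'w, 'f) hpath set" where
  "finite_paths = {\<mu>. \<mu> \<noteq> [] \<and> set \<mu> \<subseteq> segments \<and>
     (\<forall>j. Suc j < length \<mu> \<longrightarrow>
        seg_src (\<mu> ! j) = seg_rng (\<mu> ! Suc j) \<and> (is_DS (\<mu> ! j) \<longleftrightarrow> \<not> is_DS (\<mu> ! Suc j))) \<and>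
     (length \<mu> > 1 \<longrightarrow> (\<forall>s \<in> set \<mu>. \<not> seg_is_vertex s)) \<and>
     (\<forall>i. CS i (idn (two_graph E F i) (v i, w i)) \<notin> set \<mu>)}"

definition is_vertex_path :: "('v, 'e, 'w, 'f) hpath \<Rightarrow> bool" where
  "is_vertex_path \<mu> \<longleftrightarrow> (\<exists>s. \<mu> = [s] \<and> seg_is_vertex s)"

definition path_cmp ::
  "('v, 'e, 'w, 'f) hpath \<Rightarrow> ('v, 'e, 'w, 'f) hpath \<Rightarrow> ('v, 'e, 'w, 'f) hpath" where
  "path_cmp \<mu> \<nu> =
    (if is_vertex_path \<mu> then \<nu>
     else if is_vertex_path \<nu> then \<mu>
     else if is_DS (last \<mu>) = is_DS (hd \<nu>)
       then butlast \<mu> @ [seg_cmp (last \<mu>) (hd \<nu>)] @ tl \<nu>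
     else \<mu> @ \<nu>)"

fun vertex_path :: "('v, 'w) hvert \<Rightarrow> ('v, 'e, 'w, 'f) hpath" where
  "vertex_path (DV x) = [DS (idn (path_cat Dgraph) x)]"
| "vertex_path (CV i x y) = [CS i (idn (two_graph E F i) (x, y))]"

definition hybrid :: "(('v, 'w) hvert, ('v, 'e, 'w, 'f) hpath) cat" where
  "hybrid =
    \<lparr>obj = DV ` obj (path_cat Dgraph) \<union> (\<Union>i. glue v w i ` obj (two_graph E F i)),
     mor = finite_paths,
     rng = (\<lambda>\<mu>. seg_rng (hd \<mu>)),
     src = (\<lambda>\<mu>. seg_src (last \<mu>)),
     idn = vertex_path,
     cmp = path_cmp\<rparr>"

text \<open>
  The product \<open>\<mu>\<^sub>1 \<dots> \<mu>\<^bsub>m-1\<^esub>\<close> of all segments of \<open>\<mu>\<close> but the last; for \<open>m = 1\<close> the empty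
  product is read as the vertex \<open>r(\<mu>)\<close>.
\<close>

definition init_path :: "('v, 'e, 'w, 'f) hpath \<Rightarrow> ('v, 'e, 'w, 'f) hpath" where
  "init_path \<mu> = (if length \<mu> = 1 then idn hybrid (rng hybrid \<mu>) else butlast \<mu>)"

end

fun seg_degree :: "('v, 'e, 'w, 'f) seg \<Rightarrow> (int \<times> int + int) list" where
  "seg_degree (DS p) = fp_inr integer_group (int (path_length p))"
| "seg_degree (CS i (a, b)) = fp_inl Z2 (int (path_length a), int (path_length b))"

definition hybrid_degree :: "('v, 'e, 'w, 'f) hpath \<Rightarrow> (int \<times> int + int) list" where
  "hybrid_degree \<mu> = foldr (\<lambda>s g. seg_degree s \<otimes>\<^bsub>Z2_free_Z\<^esub> g) \<mu> \<one>\<^bsub>Z2_free_Z\<^esub>"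

definition hybrid_MCE :: "(ix \<Rightarrow> ('v, 'e) pre_digraph) \<Rightarrow> (ix \<Rightarrow> ('w, 'f) pre_digraph)
    \<Rightarrow> (ix \<Rightarrow> 'v) \<Rightarrow> (ix \<Rightarrow> 'w) \<Rightarrow> ('v, 'e, 'w, 'f) hpath \<Rightarrow> ('v, 'e, 'w, 'f) hpath
    \<Rightarrow> ('v, 'e, 'w, 'f) hpath set" where
  "hybrid_MCE E F v w = MCE Z2_free_Z N2_free_N (hybrid E F v w) hybrid_degree"

end

theory Submission
  imports Defs
begin

text \<open>
  The degree of a finite path that is not a vertex is the reduced word of the degrees of its
  segments, one syllable for each segment. Concatenation of finite paths and multiplication of
  positive words in the free product follow the same rule: if the last syllable of the left factor
  and the first syllable of the right factor have the same type, these two are merged, and otherwise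
  the two words are put next to each other. A merged syllable is never trivial, because a product of
  positive elements is trivial only if both of them are. Hence a factorisation \<open>d(\<lambda>) =
  p q\<close> cuts \<open>\<lambda>\<close> either between two segments or inside a single one, and
  in the latter case the unique factorisation of paths in a directed graph, applied to each
  coordinate, says how to cut that segment (\<open>factorisation_exists\<close>,
  \<open>factorisation_unique\<close>).

  The same rule governs common extensions. An extension of \<open>\<mu>\<close> agrees with
  \<open>\<mu>\<close> in every segment but the last one of \<open>\<mu>\<close>, and the segment in
  that position extends the last one of \<open>\<mu>\<close> (\<open>extends_prefix\<close>;
  \<open>extendsI\<close> is the converse for paths with more segments than \<open>\<mu>\<close>).
  If \<open>\<nu>\<close> has more segments than \<open>\<mu>\<close>, a common extension of the two
  therefore exists only if \<open>\<nu>\<close> itself extends \<open>\<mu>\<close>, and then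
  \<open>\<nu>\<close> is the only minimal one. If both have the same number of segments and differ
  before the last one, there is no common extension; if they do not, the common initial part can be
  split off, since left multiplication by an element commutes with forming minimal common extensions
  in every P-graph (\<open>MCE_left_mult\<close>). There remain single segments. If one of them is a
  vertex, a minimal common extension can only be the other one; if they are of different types and
  not vertices, there is no common extension; and if they are of the same type, the coordinates of a
  minimal common extension, one in \<open>D\<close> and two in a 2-graph, have lengths bounded by
  the maxima of the given lengths, so each of them is one of the two given paths, and only finitely
  many extensions are possible.

  That the free product is quasi-lattice ordered again is a separate argument about reduced words
  (\<open>least_positive_multiple\<close>): for \<open>P\<close> the positive cone of the free
  product, a nonempty set \<open>P \<inter> g P\<close> has the form \<open>r P\<close>. If
  \<open>g\<close> is not the identity, it is in reduced form a positive word, followed by one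
  syllable that need not be positive, followed by the inverse of a positive word, and
  \<open>r\<close> is the positive word in front multiplied by the join of that syllable with the
  identity.
\<close>

section \<open>Free products of groups\<close>

locale group_pair = G: group G + H: group H
  for G :: "('a, 'x) monoid_scheme" and H :: "('b, 'y) monoid_scheme"
begin

text \<open>
  A syllable is an element of one of the two groups, the identity included. Admitting trivial
  syllables makes them a group for each of the two types, and spares case distinctions on whether a
  product of two syllables cancels.
\<close>

fun syl :: "'a + 'b \<Rightarrow> bool" where
  "syl (Inl a) \<longleftrightarrow> a \<in> carrier G"
| "syl (Inr b) \<longleftrightarrow> b \<in> carrier H"

fun triv :: "'a + 'b \<Rightarrow> bool" where
  "triv (Inl a) \<longleftrightarrow> a = \<one>\<^bsub>G\<^esub>"
| "triv (Inr b) \<longleftrightarrow> b = \<one>\<^bsub>H\<^esub>"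

text \<open>
  The product is meaningful for syllables of the same type; the last clause only keeps the type of
  the left factor.
\<close>

fun smul :: "'a + 'b \<Rightarrow> 'a + 'b \<Rightarrow> 'a + 'b" where
  "smul (Inl a) (Inl a') = Inl (a \<otimes>\<^bsub>G\<^esub> a')"
| "smul (Inr b) (Inr b') = Inr (b \<otimes>\<^bsub>H\<^esub> b')"
| "smul s t = s"

fun sinv :: "'a + 'b \<Rightarrow> 'a + 'b" where
  "sinv (Inl a) = Inl (inv\<^bsub>G\<^esub> a)"
| "sinv (Inr b) = Inr (inv\<^bsub>H\<^esub> b)"

definition emb :: "'a + 'b \<Rightarrow> ('a + 'b) list" where
  "emb s = (if triv s then [] else [s])"

definition act :: "'a + 'b \<Rightarrow> ('a + 'b) list \<Rightarrow> ('a + 'b) list" where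
  "act s u = (if triv s then u else fp_cons G H s u)"

text \<open>
  A word that starts off type \<open>k\<close> can be prefixed by a syllable of type
  \<open>k\<close> without a reduction. The empty word qualifies for both types.
\<close>

definition starts_off :: "bool \<Rightarrow> ('a + 'b) list \<Rightarrow> bool" where
  "starts_off k u \<longleftrightarrow> u = [] \<or> isl (hd u) \<noteq> k"

definition ends_off :: "bool \<Rightarrow> ('a + 'b) list \<Rightarrow> bool" where
  "ends_off k u \<longleftrightarrow> u = [] \<or> isl (last u) \<noteq> k"

abbreviation words :: "('a + 'b) list set" where
  "words \<equiv> carrier (free_product G H)"

lemma letter_iff: "fp_letter G H s \<longleftrightarrow> syl s \<and> \<not> triv s"
  by (cases s) auto

lemma isl_smul [simp]: "isl (smul s t) = isl s"
  by (cases s; cases t) auto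

lemma isl_sinv [simp]: "isl (sinv s) = isl s"
  by (cases s) auto

lemma syl_smul: "syl s \<Longrightarrow> syl t \<Longrightarrow> syl (smul s t)"
  by (cases s; cases t) auto

lemma syl_sinv: "syl s \<Longrightarrow> syl (sinv s)"
  by (cases s) auto

lemma triv_sinv: "syl s \<Longrightarrow> triv (sinv s) \<longleftrightarrow> triv s"
  by (cases s) auto

lemma triv_smul_sinv: "syl s \<Longrightarrow> triv (smul (sinv s) s)"
  by (cases s) auto

lemma triv_smul_sinv_right: "syl s \<Longrightarrow> triv (smul s (sinv s))"
  by (cases s) auto

lemma triv_smul_sinv_eq:
  "syl s \<Longrightarrow> syl t \<Longrightarrow> isl s = isl t \<Longrightarrow> triv (smul s (sinv t)) \<Longrightarrow> s = t"
  by (cases s; cases t) (auto simp: G.inv_solve_right' H.inv_solve_right')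

lemma smul_assoc:
  "syl s \<Longrightarrow> syl t \<Longrightarrow> syl r \<Longrightarrow> isl s = isl t \<Longrightarrow> isl t = isl r
    \<Longrightarrow> smul s (smul t r) = smul (smul s t) r"
  by (cases s; cases t; cases r) (auto simp: G.m_assoc H.m_assoc)

lemma smul_triv_left: "triv s \<Longrightarrow> syl t \<Longrightarrow> isl s = isl t \<Longrightarrow> smul s t = t"
  by (cases s; cases t) auto

lemma smul_triv_right: "triv t \<Longrightarrow> syl s \<Longrightarrow> isl s = isl t \<Longrightarrow> smul s t = s"
  by (cases s; cases t) auto

lemma trivial_syllable: "\<exists>s. syl s \<and> triv s \<and> isl s = k"
proof (cases k)
  case True
  then show ?thesis by (intro exI[of _ "Inl \<one>\<^bsub>G\<^esub>"]) auto
next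
  case False
  then show ?thesis by (intro exI[of _ "Inr \<one>\<^bsub>H\<^esub>"]) auto
qed

lemma Nil_words [simp]: "[] \<in> words"
  by (simp add: free_product_def)

lemma Cons_words:
  "s # u \<in> words \<longleftrightarrow> syl s \<and> \<not> triv s \<and> u \<in> words \<and> starts_off (isl s) u"
  by (cases u) (auto simp: free_product_def letter_iff starts_off_def)

lemma append_words:
  "u @ u' \<in> words \<longleftrightarrow>
     u \<in> words \<and> u' \<in> words \<and> (u = [] \<or> starts_off (isl (last u)) u')"
  by (auto simp: free_product_def successively_append_iff starts_off_def)

lemma snoc_words:
  "u @ [s] \<in> words \<longleftrightarrow> u \<in> words \<and> syl s \<and> \<not> triv s \<and> ends_off (isl s) u"
  by (auto simp: append_words Cons_words starts_off_def ends_off_def)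

lemma emb_append_words:
  "u \<in> words \<Longrightarrow> syl t \<Longrightarrow> starts_off (isl t) u \<Longrightarrow> emb t @ u \<in> words"
  by (auto simp: emb_def Cons_words)

lemma emb_words: "syl t \<Longrightarrow> emb t \<in> words"
  by (auto simp: emb_def Cons_words starts_off_def)

text \<open>
  The syllable \<open>t\<close> is trivial if \<open>u\<close> does not start with type
  \<open>k\<close>. This presentation of a word relative to a type is what makes multiplication by a
  syllable of that type a one-step computation, by \<open>act_emb\<close>.
\<close>

lemma split_words:
  assumes "u \<in> words"
  obtains t u' where "syl t" "isl t = k" "u = emb t @ u'" "u' \<in> words" "starts_off k u'"
proof (cases "starts_off k u")
  case True
  obtain t where "syl t" "triv t" "isl t = k" using trivial_syllable by blast
  then show ?thesis using that[of t u] assms True by (auto simp: emb_def)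
next
  case False
  then obtain t u' where "u = t # u'" "isl t = k" by (cases u) (auto simp: starts_off_def)
  then show ?thesis using that[of t u'] assms by (auto simp: emb_def Cons_words)
qed

lemma fp_cons_off: "starts_off (isl s) u \<Longrightarrow> fp_cons G H s u = s # u"
  by (cases s; cases u rule: list.exhaust; cases "hd u") (auto simp: starts_off_def)

lemma act_off: "starts_off (isl s) u \<Longrightarrow> act s u = emb s @ u"
  by (auto simp: act_def emb_def fp_cons_off)

lemma fp_cons_same: "isl s = isl t \<Longrightarrow> fp_cons G H s (t # u) = emb (smul s t) @ u"
  by (cases s; cases t) (auto simp: emb_def)

lemma act_emb:
  assumes "syl s" "syl t" "isl s = isl t" "starts_off (isl t) u"
  shows "act s (emb t @ u) = emb (smul s t) @ u"
proof (cases "triv t")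
  case True
  then show ?thesis using assms
    by (simp add: act_off emb_def[of t] smul_triv_right)
next
  case False
  then show ?thesis using assms
    by (auto simp: act_def emb_def[of t] fp_cons_same smul_triv_left)
qed

lemma act_words: "syl s \<Longrightarrow> u \<in> words \<Longrightarrow> act s u \<in> words"
  by (rule split_words[of u "isl s"])
    (auto simp: act_emb intro!: emb_append_words syl_smul)

text \<open>
  Following van der Waerden, associativity of the product of reduced words comes from the two groups
  acting on them: with \<open>u = r u'\<close> split at the common type, both sides are \<open>(s t
  r) u'\<close>.
\<close>

lemma act_act:
  assumes "syl s" "syl t" "isl s = isl t" "u \<in> words"
  shows "act s (act t u) = act (smul s t) u"
proof (rule split_words[OF assms(4), of "isl t"])
  fix r u' assume "syl r" "isl r = isl t" "u = emb r @ u'" "starts_off (isl t) u'"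
  then show ?thesis using assms by (simp add: act_emb syl_smul smul_assoc)
qed

abbreviation fmult (infixl "\<bullet>" 70) where
  "u \<bullet> u' \<equiv> u \<otimes>\<^bsub>free_product G H\<^esub> u'"

lemma fmult_Nil [simp]: "[] \<bullet> u = u"
  by (simp add: free_product_def)

lemma fmult_Cons: "\<not> triv s \<Longrightarrow> (s # u) \<bullet> u' = act s (u \<bullet> u')"
  by (simp add: free_product_def act_def)

lemma one_free_product [simp]: "\<one>\<^bsub>free_product G H\<^esub> = []"
  by (simp add: free_product_def)

lemma emb_fmult: "emb s \<bullet> u = act s u"
  by (auto simp: emb_def fmult_Cons act_def)

lemma fmult_words: "u \<in> words \<Longrightarrow> u' \<in> words \<Longrightarrow> u \<bullet> u' \<in> words"
  by (induction u) (auto simp: Cons_words fmult_Cons act_words)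

lemma act_fmult:
  assumes "syl s" "u \<in> words" "u' \<in> words"
  shows "act s u \<bullet> u' = act s (u \<bullet> u')"
proof (rule split_words[OF assms(2), of "isl s"])
  fix t u1 assume *: "syl t" "isl t = isl s" "u = emb t @ u1" "u1 \<in> words" "starts_off (isl s) u1"
  have emb: "(emb r @ u1) \<bullet> u' = act r (u1 \<bullet> u')" for r
    by (auto simp: emb_def fmult_Cons act_def)
  have "act s u \<bullet> u' = act (smul s t) (u1 \<bullet> u')"
    using * assms by (simp add: act_emb emb)
  also have "\<dots> = act s (act t (u1 \<bullet> u'))"
    using * assms by (simp add: act_act fmult_words)
  finally show ?thesis using * by (simp add: emb)
qed

lemma fmult_append:
  assumes "u @ u' \<in> words" shows "u \<bullet> u' = u @ u'"
  using assms
proof (induction u)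
  case (Cons s u)
  then show ?case by (auto simp: Cons_words fmult_Cons act_off emb_def)
qed simp

theorem free_product_group: "group (free_product G H)"
proof (rule groupI)
  show "x \<bullet> y \<bullet> z = x \<bullet> (y \<bullet> z)" if "x \<in> words" "y \<in> words" "z \<in> words" for x y z
    using that by (induction x) (auto simp: Cons_words fmult_Cons act_fmult fmult_words)
  note assoc = this
  show "\<exists>y \<in> words. y \<bullet> x = \<one>\<^bsub>free_product G H\<^esub>" if "x \<in> words" for x
    using that
  proof (induction x)
    case (Cons s u)
    then obtain y where y: "y \<in> words" "y \<bullet> u = []" by (auto simp: Cons_words)
    have s: "syl s" "\<not> triv s" "u \<in> words" using Cons.prems by (auto simp: Cons_words)
    have "emb (sinv s) \<bullet> (s # u) = act (sinv s) (emb s @ u)"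
      using s by (simp add: emb_fmult emb_def[of s])
    also have "\<dots> = act (smul (sinv s) s) u"
      using Cons.prems by (simp add: Cons_words act_emb act_off syl_sinv)
    also have "\<dots> = u" using triv_smul_sinv[OF s(1)] by (simp add: act_def)
    finally have "y \<bullet> emb (sinv s) \<bullet> (s # u) = []"
      using y Cons.prems s by (simp add: assoc emb_words syl_sinv)
    then show ?case using y s by (auto intro!: bexI[of _ "y \<bullet> emb (sinv s)"] fmult_words emb_words syl_sinv)
  qed (auto intro: bexI[of _ "[]"])
qed (auto intro: fmult_words)

end

section \<open>Free products of quasi-lattice ordered groups\<close>

context quasi_lattice_ordered
begin

lemma one_in_P: "\<one> \<in> P"
  using P_inter_inv by blast

lemma inv_notin_P:
  assumes "p \<in> P" "p \<noteq> \<one>" shows "inv p \<notin> P"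
proof
  assume "inv p \<in> P"
  then have "inv (inv p) \<in> (\<lambda>p. inv p) ` P" by (rule imageI)
  moreover have "inv (inv p) = p" using assms P_subset by (simp add: subset_iff)
  ultimately show False using assms P_inter_inv by auto
qed

lemma mult_eq_one_P:
  assumes "p \<in> P" "q \<in> P" "p \<otimes> q = \<one>" shows "p = \<one>"
proof -
  have "q = inv p" using assms P_subset by (metis inv_equality inv_inv inv_closed subsetD)
  then show ?thesis using assms inv_notin_P by blast
qed

lemma ql_le_antisym:
  assumes "p \<in> carrier G" "q \<in> carrier G" "ql_le G P p q" "ql_le G P q p"
  shows "p = q"
proof -
  have "(inv p \<otimes> q) \<otimes> (inv q \<otimes> p) = inv p \<otimes> ((q \<otimes> inv q) \<otimes> p)"
    using assms(1,2) by (simp only: m_assoc inv_closed m_closed)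
  then have "inv p \<otimes> q = \<one>"
    using assms mult_eq_one_P[of "inv p \<otimes> q" "inv q \<otimes> p"] by (simp add: ql_le_def)
  then show ?thesis using assms inv_equality[of "inv p" q] by (metis inv_closed inv_inv)
qed

lemma ql_join_eqI:
  assumes "ql_is_join G P p q x" shows "ql_join G P p q = x"
  unfolding ql_join_def
proof (rule the_equality)
  fix y assume "ql_is_join G P p q y"
  then show "y = x" using assms P_subset
    by (intro ql_le_antisym) (auto simp: ql_is_join_def ql_ubs_def)
qed (rule assms)

lemma join_over_one:
  assumes "c \<in> carrier G" "t \<in> P" "inv c \<otimes> t \<in> P"
  shows "\<exists>r \<in> P. inv c \<otimes> r \<in> P \<and> (\<forall>t \<in> P. inv c \<otimes> t \<in> P \<longrightarrow> inv r \<otimes> t \<in> P)"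
proof -
  have ubs: "ql_ubs G P \<one> c = {x \<in> P. inv c \<otimes> x \<in> P}"
    using P_subset by (auto simp: ql_ubs_def ql_le_def subset_iff)
  have "t \<in> ql_ubs G P \<one> c"
    using assms by (simp add: ubs)
  then obtain r where "ql_is_join G P \<one> c r" using join_exists[of \<one> c] assms by auto
  then show ?thesis by (intro bexI[of _ r]) (auto simp: ql_is_join_def ubs ql_le_def)
qed

end

text \<open>
  It is enough to take the join of an element \<open>g\<close> with the identity, that is, to find
  the least element of \<open>P \<inter> g P\<close>. Common upper bounds of \<open>p\<close> and
  \<open>q\<close> in \<open>P\<close> are obtained in two such steps: those above \<open>p\<close>
  form some \<open>r P\<close>, and within \<open>r P\<close> the condition for \<open>q\<close> is
  the one for \<open>inv r \<otimes> q\<close>.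
\<close>

lemma (in group) quasi_lattice_orderedI:
  assumes sub: "P \<subseteq> carrier G" and closed: "\<And>p q. p \<in> P \<Longrightarrow> q \<in> P \<Longrightarrow> p \<otimes> q \<in> P"
    and inter: "P \<inter> (\<lambda>p. inv p) ` P = {\<one>}"
    and least: "\<And>g x. g \<in> carrier G \<Longrightarrow> x \<in> P \<Longrightarrow> inv g \<otimes> x \<in> P
      \<Longrightarrow> \<exists>r \<in> P. inv g \<otimes> r \<in> P \<and> (\<forall>x \<in> P. inv g \<otimes> x \<in> P \<longrightarrow> inv r \<otimes> x \<in> P)"
  shows "quasi_lattice_ordered G P"
proof (unfold_locales; (rule closed | fact sub | fact inter)?)
  fix p q assume p: "p \<in> carrier G" and q: "q \<in> carrier G" and "ql_ubs G P p q \<noteq> {}"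
  then obtain x where x: "x \<in> P" "inv p \<otimes> x \<in> P" "inv q \<otimes> x \<in> P"
    by (auto simp: ql_ubs_def ql_le_def)
  from least[OF p x(1,2)] obtain r where r: "r \<in> P" "inv p \<otimes> r \<in> P"
    and r_least: "\<And>x. x \<in> P \<Longrightarrow> inv p \<otimes> x \<in> P \<Longrightarrow> inv r \<otimes> x \<in> P" by blast
  have G: "r \<in> carrier G" "\<And>x. x \<in> P \<Longrightarrow> x \<in> carrier G" using r sub by auto
  have g: "inv (inv r \<otimes> q) \<otimes> (inv r \<otimes> y) = inv q \<otimes> y" if "y \<in> carrier G" for y
    using that G q by (simp add: inv_mult_group m_assoc) (simp flip: m_assoc)
  from least[of "inv r \<otimes> q" "inv r \<otimes> x"] g[of x] obtain r' where r': "r' \<in> P"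
      "inv (inv r \<otimes> q) \<otimes> r' \<in> P"
    and r'_least: "\<And>y. y \<in> P \<Longrightarrow> inv (inv r \<otimes> q) \<otimes> y \<in> P \<Longrightarrow> inv r' \<otimes> y \<in> P"
    using q x r_least G by auto
  have "ql_is_join G P p q (r \<otimes> r')"
    unfolding ql_is_join_def ql_ubs_def ql_le_def
  proof (intro conjI CollectI ballI)
    show "r \<otimes> r' \<in> P" using r r' closed by blast
    show "inv p \<otimes> (r \<otimes> r') \<in> P"
      using closed[OF r(2) r'(1)] p G r' by (simp add: m_assoc)
    show "inv q \<otimes> (r \<otimes> r') \<in> P"
      using r'(2) q G r' by (simp add: inv_mult_group m_assoc)
    fix y assume "y \<in> {x \<in> P. inv p \<otimes> x \<in> P \<and> inv q \<otimes> x \<in> P}"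
    then have "inv r' \<otimes> (inv r \<otimes> y) \<in> P" using r_least r'_least g[of y] G by auto
    then show "inv (r \<otimes> r') \<otimes> y \<in> P"
      using \<open>y \<in> _\<close> G r' by (simp add: inv_mult_group m_assoc)
  qed
  then show "\<exists>x. ql_is_join G P p q x" ..
qed

locale ql_pair = group_pair G H + qG: quasi_lattice_ordered G P + qH: quasi_lattice_ordered H Q
  for G :: "('a, 'x) monoid_scheme" and P and H :: "('b, 'y) monoid_scheme" and Q
begin

sublocale FP: group "free_product G H"
  by (rule free_product_group)

abbreviation inv_word where "inv_word \<equiv> m_inv (free_product G H)"

fun pos :: "'a + 'b \<Rightarrow> bool" where
  "pos (Inl a) \<longleftrightarrow> a \<in> P"
| "pos (Inr b) \<longleftrightarrow> b \<in> Q"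

abbreviation pwords :: "('a + 'b) list set" where
  "pwords \<equiv> fp_submonoid G P H Q"

lemma pos_syl: "pos s \<Longrightarrow> syl s"
  using qG.P_subset qH.P_subset by (cases s) auto

lemma pos_smul: "pos s \<Longrightarrow> pos t \<Longrightarrow> pos (smul s t)"
  using qG.P_closed qH.P_closed by (cases s; cases t) auto

lemma triv_pos: "triv s \<Longrightarrow> pos s"
  using qG.one_in_P qH.one_in_P by (cases s) auto

lemma pos_sinv: "pos s \<Longrightarrow> \<not> triv s \<Longrightarrow> \<not> pos (sinv s)"
  using qG.inv_notin_P qH.inv_notin_P by (cases s) auto

lemma triv_smul_pos: "pos s \<Longrightarrow> pos t \<Longrightarrow> isl s = isl t \<Longrightarrow> triv (smul s t) \<longleftrightarrow> triv s \<and> triv t"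
  using qG.mult_eq_one_P[of "projl s" "projl t"] qH.mult_eq_one_P[of "projr s" "projr t"]
    qG.P_subset qH.P_subset by (cases s; cases t) auto

lemma pwords_iff: "u \<in> pwords \<longleftrightarrow> u \<in> words \<and> (\<forall>s \<in> set u. pos s)"
proof -
  have "s \<in> Inl ` P \<union> Inr ` Q \<longleftrightarrow> pos s" for s by (cases s) auto
  then have "Inl ` P \<union> Inr ` Q = Collect pos" by blast
  then show ?thesis unfolding fp_submonoid_def by auto
qed

lemma emb_append_pwords:
  assumes "syl t" "starts_off (isl t) u" "u \<in> words"
  shows "emb t @ u \<in> pwords \<longleftrightarrow> pos t \<and> u \<in> pwords"
  using assms emb_append_words[OF assms(3,1,2)] triv_pos by (auto simp: pwords_iff emb_def)

lemma emb_pwords: "syl t \<Longrightarrow> emb t \<in> pwords \<longleftrightarrow> pos t"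
  using emb_append_pwords[of t "[]"] by (simp add: starts_off_def pwords_iff)

lemma pwords_words: "u \<in> pwords \<Longrightarrow> u \<in> words"
  by (simp add: pwords_iff)

lemma fmult_pwords:
  assumes "u \<in> pwords" "u' \<in> pwords" shows "u \<bullet> u' \<in> pwords"
  using assms
proof (induction u)
  case (Cons s u)
  have s: "pos s" "u \<in> pwords" "syl s" "\<not> triv s"
    using Cons.prems by (auto simp: pwords_iff Cons_words)
  then have "u \<bullet> u' \<in> pwords" using Cons by blast
  from split_words[OF pwords_words[OF this], of "isl s"] obtain t u1 where
    "syl t" "isl t = isl s" "u \<bullet> u' = emb t @ u1" "u1 \<in> words" "starts_off (isl s) u1" .
  then show ?case using s \<open>u \<bullet> u' \<in> pwords\<close>
    by (simp add: fmult_Cons act_emb emb_append_pwords syl_smul pos_smul)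
qed simp

text \<open>
  Positive syllables never cancel, so that at most one merging takes place in a product of positive
  words. Composition of finite paths is defined by the same case distinction.
\<close>

lemma fmult_pos:
  assumes "u \<in> pwords" "u' \<in> pwords" "u \<noteq> []" "u' \<noteq> []"
  shows "u \<bullet> u' = (if isl (last u) = isl (hd u')
    then butlast u @ [smul (last u) (hd u')] @ tl u' else u @ u')"
  using assms
proof (induction u)
  case (Cons s u)
  have s: "pos s" "u \<in> pwords" "syl s" "\<not> triv s" "starts_off (isl s) u"
    using Cons.prems by (auto simp: pwords_iff Cons_words)
  show ?case
  proof (cases "u = []")
    case True
    obtain t u1 where u': "u' = t # u1" using Cons.prems by (cases u') auto
    have t: "pos t" using Cons.prems(2) by (auto simp: u' pwords_iff)
    show ?thesis
      using True s t triv_smul_pos[OF s(1) t]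
      by (auto simp: u' fmult_Cons act_def fp_cons_same fp_cons_off starts_off_def emb_def)
  next
    case False
    have "starts_off (isl s) (u \<bullet> u')"
      using s(5) False Cons s by (auto simp: starts_off_def hd_append neq_Nil_conv split: if_splits)
    then show ?thesis using s Cons False by (simp add: fmult_Cons act_off emb_def)
  qed
qed simp

lemma fmult_pos_Nil: "u \<in> pwords \<Longrightarrow> u' \<in> pwords \<Longrightarrow> u \<bullet> u' = [] \<longleftrightarrow> u = [] \<and> u' = []"
  by (cases "u = []"; cases "u' = []")
    (use FP.r_one pwords_words in \<open>auto simp: fmult_pos\<close>)

lemma syllable_join:
  assumes "syl c" "pos t" "isl t = isl c" "pos (smul (sinv c) t)"
  obtains r where "pos r" "isl r = isl c" "pos (smul (sinv c) r)"
    "\<And>t. pos t \<Longrightarrow> isl t = isl c \<Longrightarrow> pos (smul (sinv c) t) \<Longrightarrow> pos (smul (sinv r) t)"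
proof (cases c)
  case (Inl a)
  then obtain b where "t = Inl b" using assms by (cases t) auto
  with qG.join_over_one[of a b] assms Inl obtain r where
    "r \<in> P" "inv\<^bsub>G\<^esub> a \<otimes>\<^bsub>G\<^esub> r \<in> P" "\<forall>t \<in> P. inv\<^bsub>G\<^esub> a \<otimes>\<^bsub>G\<^esub> t \<in> P \<longrightarrow> inv\<^bsub>G\<^esub> r \<otimes>\<^bsub>G\<^esub> t \<in> P"
    by auto
  note r = this
  have "pos (smul (sinv (Inl r)) t')"
    if "pos t'" "isl t' = isl c" "pos (smul (sinv c) t')" for t'
    using that r Inl by (cases t') auto
  then show ?thesis using that[of "Inl r"] r Inl by auto
next
  case (Inr a)
  then obtain b where "t = Inr b" using assms by (cases t) auto
  with qH.join_over_one[of a b] assms Inr obtain r where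
    "r \<in> Q" "inv\<^bsub>H\<^esub> a \<otimes>\<^bsub>H\<^esub> r \<in> Q" "\<forall>t \<in> Q. inv\<^bsub>H\<^esub> a \<otimes>\<^bsub>H\<^esub> t \<in> Q \<longrightarrow> inv\<^bsub>H\<^esub> r \<otimes>\<^bsub>H\<^esub> t \<in> Q"
    by auto
  note r = this
  have "pos (smul (sinv (Inr r)) t')"
    if "pos t'" "isl t' = isl c" "pos (smul (sinv c) t')" for t'
    using that r Inr by (cases t') auto
  then show ?thesis using that[of "Inr r"] r Inr by auto
qed

lemma fmult_Nil_right: "u \<in> words \<Longrightarrow> u \<bullet> [] = u"
  using FP.r_one[of u] by simp

lemma inv_emb:
  assumes "syl s" shows "inv_word (emb s) = emb (sinv s)"
proof (rule FP.inv_equality)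
  have "emb (sinv s) \<bullet> emb s = emb (smul (sinv s) s)"
    using act_emb[of "sinv s" s "[]"] assms by (simp add: emb_fmult syl_sinv starts_off_def)
  then show "emb (sinv s) \<bullet> emb s = \<one>\<^bsub>free_product G H\<^esub>"
    using triv_smul_sinv[OF assms] by (simp add: emb_def)
qed (use assms in \<open>auto intro: emb_words syl_sinv\<close>)

lemma snoc_fmult: "u @ [s] \<in> words \<Longrightarrow> u @ [s] = u \<bullet> emb s"
  using fmult_append[of u "[s]"] by (simp add: snoc_words emb_def)

text \<open>
  Removing a positive word \<open>x\<close> from the left of a positive word \<open>z\<close> either
  succeeds within the positive words, or leaves in front a syllable that is not positive. Once such
  a syllable has appeared, the remaining syllables of \<open>x\<close> are of alternating types and
  are put in front of it as inverses, so that the type of the first syllable is always that of the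
  last syllable of \<open>x\<close>.
\<close>

lemma cancel_positive:
  assumes "x \<in> pwords" "z \<in> pwords" "ends_off k x"
  shows "inv_word x \<bullet> z \<in> pwords \<or>
    (\<exists>s u. inv_word x \<bullet> z = s # u \<and> isl s \<noteq> k \<and> \<not> pos s)"
  using assms(1,3)
proof (induction x arbitrary: k rule: rev_induct)
  case Nil
  then show ?case using FP.inv_one assms(2) by simp
next
  case (snoc s x)
  have s: "pos s" "syl s" "\<not> triv s" and x: "x \<in> pwords" "ends_off (isl s) x"
    using snoc.prems by (auto simp: pwords_iff snoc_words)
  have k: "isl s \<noteq> k" using snoc.prems by (auto simp: ends_off_def)
  define h where "h = inv_word x \<bullet> z"
  have h: "h \<in> words" unfolding h_def using x assms(2) by (auto intro: pwords_words)
  have "x @ [s] = x \<bullet> emb s" using snoc.prems(1) by (intro snoc_fmult) (simp add: pwords_words)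
  then have "inv_word (x @ [s]) = emb (sinv s) \<bullet> inv_word x"
    using s x by (simp add: FP.inv_mult_group pwords_words emb_words inv_emb)
  then have eq: "inv_word (x @ [s]) \<bullet> z = act (sinv s) h"
    using s x assms(2) by (simp add: act_fmult pwords_words syl_sinv h_def emb_fmult)
  consider "h \<in> pwords" | t u where "h = t # u" "isl t \<noteq> isl s" "\<not> pos t"
    using snoc.IH[OF x] unfolding h_def by blast
  then show ?case
  proof cases
    case 1
    from split_words[OF h, of "isl s"] obtain t u where
      t: "syl t" "isl t = isl s" "h = emb t @ u" "u \<in> words" "starts_off (isl s) u" .
    have "act (sinv s) h = emb (smul (sinv s) t) @ u"
      using t s by (simp add: act_emb syl_sinv)
    moreover have "u \<in> pwords" using 1 t by (simp add: emb_append_pwords)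
    moreover have "emb (smul (sinv s) t) @ u \<in> pwords \<longleftrightarrow> pos (smul (sinv s) t) \<and> u \<in> pwords"
      using t s by (intro emb_append_pwords) (auto intro: syl_smul syl_sinv)
    ultimately show ?thesis using k triv_pos[of "smul (sinv s) t"]
      by (cases "pos (smul (sinv s) t)") (auto simp: eq emb_def)
  next
    case 2
    then have "act (sinv s) h = sinv s # h"
      using s by (simp add: act_off starts_off_def emb_def triv_sinv)
    then show ?thesis using s k by (simp add: eq pos_sinv)
  qed
qed

lemma fmult_not_positive:
  assumes "y \<in> words" "ends_off (isl s) y" "s # u \<in> words" "\<not> pos s"
  shows "y \<bullet> (s # u) \<notin> pwords"
proof -
  have "y @ s # u \<in> words"
    using assms by (auto simp: append_words starts_off_def ends_off_def)
  then show ?thesis using assms(4) by (simp add: fmult_append pwords_iff)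
qed

text \<open>
  Equal last syllables of \<open>x\<close> and \<open>y\<close> cancel, and the process stops at the
  latest when one of the two words is used up. Since \<open>x \<noteq> y\<close>, something is left:
  either the last syllables are of the same type and \<open>c\<close> is their nontrivial quotient,
  or \<open>c\<close> is the last syllable of \<open>x\<close>, or, if \<open>x\<close> is used up,
  the inverse of the last syllable of \<open>y\<close>.
\<close>

lemma quotient_normal_form:
  assumes "x \<in> pwords" "y \<in> pwords" "x \<noteq> y"
  shows "\<exists>x' y' c. x' \<in> pwords \<and> y' \<in> pwords \<and> syl c \<and> \<not> triv c \<and>
    ends_off (isl c) x' \<and> ends_off (isl c) y' \<and>
    x \<bullet> inv_word y = x' \<bullet> emb c \<bullet> inv_word y'"
  using assms
proof (induction x arbitrary: y rule: rev_induct)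
  case Nil
  then obtain y' t where y: "y = y' @ [t]" by (cases y rule: rev_cases) auto
  have t: "syl t" "\<not> triv t" "ends_off (isl t) y'" "y' \<in> pwords"
    using Nil.prems(2) by (auto simp: y pwords_iff snoc_words)
  have "y = y' \<bullet> emb t" unfolding y using Nil.prems(2) y by (intro snoc_fmult) (simp add: pwords_words)
  then have "inv_word y = emb (sinv t) \<bullet> inv_word y'"
    using t by (simp add: FP.inv_mult_group pwords_words emb_words inv_emb)
  then show ?case using t Nil.prems(1)
    by (intro exI[of _ "[]"] exI[of _ y'] exI[of _ "sinv t"]) (simp add: syl_sinv triv_sinv ends_off_def)
next
  case (snoc s x)
  have s: "syl s" "\<not> triv s" "ends_off (isl s) x" "x \<in> pwords"
    using snoc.prems(1) by (auto simp: pwords_iff snoc_words)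
  have xs: "x @ [s] = x \<bullet> emb s"
    using snoc.prems(1) by (intro snoc_fmult) (simp add: pwords_words)
  show ?case
  proof (cases "ends_off (isl s) y")
    case True
    then show ?thesis using s snoc.prems
      by (intro exI[of _ x] exI[of _ y] exI[of _ s]) (simp add: xs)
  next
    case False
    then obtain y' t where y: "y = y' @ [t]" and st: "isl t = isl s"
      by (cases y rule: rev_cases) (auto simp: ends_off_def)
    have t: "syl t" "\<not> triv t" "ends_off (isl t) y'" "y' \<in> pwords"
      using snoc.prems(2) by (auto simp: y pwords_iff snoc_words)
    have "y = y' \<bullet> emb t" unfolding y using snoc.prems(2) y
      by (intro snoc_fmult) (simp add: pwords_words)
    then have "inv_word y = emb (sinv t) \<bullet> inv_word y'"
      using t by (simp add: FP.inv_mult_group pwords_words emb_words inv_emb)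
    moreover have "emb s \<bullet> emb (sinv t) = emb (smul s (sinv t))"
      using act_emb[of s "sinv t" "[]"] s t st by (simp add: emb_fmult syl_sinv starts_off_def)
    ultimately have eq: "(x @ [s]) \<bullet> inv_word y = x \<bullet> emb (smul s (sinv t)) \<bullet> inv_word y'"
      using s t by (simp add: xs FP.m_assoc pwords_words emb_words syl_sinv)
        (simp add: pwords_words emb_words syl_sinv syl_smul flip: FP.m_assoc)
    show ?thesis
    proof (cases "s = t")
      case True
      then have "(x @ [s]) \<bullet> inv_word y = x \<bullet> inv_word y'"
        using eq triv_smul_sinv_right[OF s(1)] s by (simp add: emb_def pwords_words fmult_Nil_right)
      then show ?thesis using snoc.IH[of y'] s t True snoc.prems(3) y by auto
    next
      case False
      then show ?thesis using s t st eq triv_smul_sinv_eq[of s t]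
        by (intro exI[of _ x] exI[of _ y'] exI[of _ "smul s (sinv t)"]) (auto intro: syl_smul syl_sinv)
    qed
  qed
qed

text \<open>
  With \<open>g = x' c y'^-1\<close> in reduced form, suppose that \<open>z\<close> and \<open>g^-1
  z\<close> are positive. If the first syllable of \<open>x'^-1 z\<close> or of \<open>c^-1 x'^-1
  z\<close> were not positive, it would survive in \<open>g^-1 z\<close>, because the words around
  it fit together without a reduction. So \<open>x'^-1 z\<close> is positive, and its first syllable
  \<open>t\<close> of the type of \<open>c\<close>, which may be trivial, lies above
  \<open>c\<close>. Hence \<open>t\<close> lies above the join \<open>r\<close> of \<open>c\<close>
  and the identity in the factor, and the least element is \<open>x' r\<close>.
\<close>

lemma least_positive_multiple:
  assumes "g \<in> words" "x \<in> pwords" "inv_word g \<bullet> x \<in> pwords"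
  shows "\<exists>r \<in> pwords. inv_word g \<bullet> r \<in> pwords \<and>
    (\<forall>z \<in> pwords. inv_word g \<bullet> z \<in> pwords \<longrightarrow> inv_word r \<bullet> z \<in> pwords)"
proof (cases "g = []")
  case True
  then show ?thesis using FP.inv_one
    by (intro bexI[of _ "[]"]) (auto simp: pwords_iff)
next
  case False
  define y where "y = inv_word g \<bullet> x"
  have y: "y \<in> pwords" using assms y_def by simp
  have W: "g \<in> words" "x \<in> words" "y \<in> words" using assms y by (auto intro: pwords_words)
  have "x \<noteq> y"
    using W False unfolding y_def
    by (metis FP.inv_closed FP.inv_inv FP.inv_one FP.r_cancel_one one_free_product)
  moreover have "g = x \<bullet> inv_word y"
    using W(1,2) by (simp add: y_def FP.inv_mult_group flip: FP.m_assoc)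
  ultimately obtain x' y' c where x': "x' \<in> pwords" "ends_off (isl c) x'"
    and y': "y' \<in> pwords" "ends_off (isl c) y'" and c: "syl c" "\<not> triv c"
    and g: "g = x' \<bullet> emb c \<bullet> inv_word y'"
    using quotient_normal_form[OF assms(2) y] by metis
  note W' = pwords_words[OF x'(1)] pwords_words[OF y'(1)] emb_words[OF c(1)]
    emb_words[OF syl_sinv[OF c(1)]]
  have inv_g: "inv_word g \<bullet> z = y' \<bullet> (act (sinv c) (inv_word x' \<bullet> z))" if "z \<in> words" for z
    using that W' c by (simp add: g FP.inv_mult_group FP.m_assoc inv_emb flip: emb_fmult)
  have key: "\<exists>t u. inv_word x' \<bullet> z = emb t @ u \<and> pos t \<and> isl t = isl c \<and> u \<in> pwords \<and>
      starts_off (isl c) u \<and> pos (smul (sinv c) t)"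
    if z: "z \<in> pwords" "inv_word g \<bullet> z \<in> pwords" for z
  proof -
    define h where "h = inv_word x' \<bullet> z"
    have h: "h \<in> words" unfolding h_def using W' z by (auto intro: pwords_words)
    have yh: "y' \<bullet> act (sinv c) h \<in> pwords"
      using inv_g[of z] z by (simp add: h_def pwords_words)
    have "h \<in> pwords"
    proof (rule ccontr)
      assume "h \<notin> pwords"
      then obtain s u where s: "h = s # u" "isl s \<noteq> isl c" "\<not> pos s"
        using cancel_positive[OF x'(1) z(1) x'(2)] unfolding h_def by blast
      then have "act (sinv c) h = sinv c # h"
        using c by (simp add: act_off starts_off_def emb_def triv_sinv)
      moreover have "y' @ sinv c # h \<in> words"
        using s h c y' W' by (auto simp: append_words Cons_words syl_sinv triv_sinv starts_off_def ends_off_def)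
      ultimately show False using yh s by (simp add: fmult_append pwords_iff)
    qed
    from split_words[OF h, of "isl c"] obtain t u where
      t: "syl t" "isl t = isl c" "h = emb t @ u" "u \<in> words" "starts_off (isl c) u" .
    then have pt: "pos t" "u \<in> pwords" using \<open>h \<in> pwords\<close> by (auto simp: emb_append_pwords)
    have act: "act (sinv c) h = emb (smul (sinv c) t) @ u"
      using t c by (simp add: act_emb syl_sinv)
    have "pos (smul (sinv c) t)"
    proof (rule ccontr)
      assume n: "\<not> pos (smul (sinv c) t)"
      then have "act (sinv c) h = smul (sinv c) t # u"
        using act triv_pos by (auto simp: emb_def)
      then show False
        using yh n t c y' W' fmult_not_positive[of y' "smul (sinv c) t" u] act_words[OF _ h, of "sinv c"]
        by (auto simp: syl_sinv)
    qed
    then show ?thesis using t pt unfolding h_def by blast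
  qed
  from key[OF assms(2,3)] obtain t where "pos t" "isl t = isl c" "pos (smul (sinv c) t)" by blast
  from syllable_join[OF c(1) this] obtain r where r: "pos r" "isl r = isl c" "pos (smul (sinv c) r)"
    and least: "\<And>t. pos t \<Longrightarrow> isl t = isl c \<Longrightarrow> pos (smul (sinv c) t) \<Longrightarrow> pos (smul (sinv r) t)"
    by blast
  have er: "emb r \<in> pwords" "emb r \<in> words" using r by (auto simp: emb_pwords pos_syl emb_words)
  show ?thesis
  proof (intro bexI[of _ "x' \<bullet> emb r"] conjI ballI impI)
    show "x' \<bullet> emb r \<in> pwords" by (intro fmult_pwords x' er)
    have "inv_word x' \<bullet> (x' \<bullet> emb r) = emb r"
      using W' er by (simp flip: FP.m_assoc)
    then have "inv_word g \<bullet> (x' \<bullet> emb r) = y' \<bullet> act (sinv c) (emb r @ [])"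
      using inv_g[of "x' \<bullet> emb r"] W' er by simp
    also have "\<dots> = y' \<bullet> emb (smul (sinv c) r)"
      using r c by (subst act_emb) (auto simp: pos_syl syl_sinv starts_off_def)
    also have "\<dots> \<in> pwords" using r c by (intro fmult_pwords y') (simp add: emb_pwords pos_syl)
    finally show "inv_word g \<bullet> (x' \<bullet> emb r) \<in> pwords" .
  next
    fix z assume z: "z \<in> pwords" "inv_word g \<bullet> z \<in> pwords"
    from key[OF z] obtain t u where t: "inv_word x' \<bullet> z = emb t @ u" "pos t" "isl t = isl c"
      "u \<in> pwords" "starts_off (isl c) u" "pos (smul (sinv c) t)" by blast
    have "inv_word (x' \<bullet> emb r) \<bullet> z = act (sinv r) (inv_word x' \<bullet> z)"
      using W' er r z by (simp add: FP.inv_mult_group FP.m_assoc pwords_words inv_emb pos_syl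
          emb_words syl_sinv flip: emb_fmult)
    also have "\<dots> = emb (smul (sinv r) t) @ u"
      using r t by (simp add: act_emb pos_syl syl_sinv)
    also have "\<dots> \<in> pwords"
      using least[OF t(2,3,6)] t r by (subst emb_append_pwords) (auto simp: pos_syl pwords_words)
    finally show "inv_word (x' \<bullet> emb r) \<bullet> z \<in> pwords" .
  qed
qed

theorem free_product_ql: "quasi_lattice_ordered (free_product G H) (fp_submonoid G P H Q)"
proof (rule FP.quasi_lattice_orderedI)
  show "pwords \<inter> inv_word ` pwords = {\<one>\<^bsub>free_product G H\<^esub>}"
  proof -
    have "p = []" if "p \<in> pwords" "inv_word p \<in> pwords" for p
      using fmult_pos_Nil[OF that] FP.r_inv[of p] that by (simp add: pwords_words)
    moreover have "[] \<in> pwords" by (simp add: pwords_iff)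
    ultimately show ?thesis using FP.inv_one FP.inv_inv
      by (auto simp: image_iff pwords_words) (metis fmult_pos_Nil pwords_words FP.l_inv one_free_product)+
  qed
qed (auto intro: fmult_pwords least_positive_multiple simp: pwords_words)

lemma ql_le_emb:
  assumes "syl s" "syl t" "isl s = isl t"
  shows "ql_le (free_product G H) pwords (emb s) (emb t) \<longleftrightarrow> pos (smul (sinv s) t)"
proof -
  have "inv_word (emb s) \<bullet> emb t = act (sinv s) (emb t @ [])"
    using assms by (simp add: inv_emb emb_fmult)
  also have "\<dots> = emb (smul (sinv s) t)"
    using assms by (subst act_emb) (auto simp: syl_sinv starts_off_def)
  finally show ?thesis using assms by (simp add: ql_le_def emb_pwords syl_smul syl_sinv)
qed

text \<open>
  The positive words dividing a syllable are syllables of the same type, because positive words do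
  not get shorter when they are multiplied.
\<close>

lemma below_emb:
  assumes "u \<in> pwords" "u \<noteq> []" "syl c" "ql_le (free_product G H) pwords u (emb c)"
  shows "\<exists>k. u = [k] \<and> isl k = isl c \<and> pos (smul (sinv k) c)"
proof -
  define z where "z = inv_word u \<bullet> emb c"
  have u: "u \<in> words" using assms(1) by (rule pwords_words)
  have z: "z \<in> pwords" using assms(4) by (simp add: z_def ql_le_def)
  have uz: "emb c = u \<bullet> z" using u assms(3) by (simp add: z_def emb_words flip: FP.m_assoc)
  show ?thesis
  proof (cases "z = []")
    case True
    then have "u = [c]" using uz u assms(2) by (auto simp: fmult_Nil_right emb_def split: if_splits)
    then show ?thesis using triv_smul_sinv[OF assms(3)] triv_pos by auto
  next
    case False
    note mult = fmult_pos[OF assms(1) z assms(2) False]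
    have "length (emb c) \<le> 1" by (simp add: emb_def)
    then have "length (u \<bullet> z) \<le> 1" using uz by simp
    then have len: "isl (last u) = isl (hd z)" "length u = 1" "length z = 1"
      using mult assms(2) False by (cases u; cases z; auto split: if_splits)+
    then obtain k k' where uk: "u = [k]" "z = [k']" by (auto simp: length_Suc_conv)
    then have c: "c = smul k k'"
      using len(1) mult uz by (auto simp: emb_def split: if_splits)
    have kk: "syl k" "syl k'" "isl k = isl k'" "pos k'"
      using assms(1) z len(1) uk by (auto simp: pwords_iff Cons_words)
    then have "smul (sinv k) c = k'"
      using triv_smul_sinv[OF kk(1)] by (simp add: c smul_assoc syl_sinv smul_triv_left)
    then show ?thesis using uk kk c by auto
  qed
qed

end

section \<open>Minimal common extensions in P-graphs\<close>

lemma MCE_commute: "MCE G P L d f g = MCE G P L d g f"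
proof -
  have "ql_ubs G P p q = ql_ubs G P q p" for p q by (auto simp: ql_ubs_def)
  then have "ql_join G P p q = ql_join G P q p" for p q
    by (simp add: ql_join_def ql_is_join_def)
  then show ?thesis
    using \<open>\<And>p q. ql_ubs G P p q = ql_ubs G P q p\<close>[of "d f" "d g"]
    unfolding MCE_def by auto
qed

context quasi_lattice_ordered
begin

lemma left_cancel_P:
  "p \<in> P \<Longrightarrow> q \<in> P \<Longrightarrow> r \<in> P \<Longrightarrow> p \<otimes> q = p \<otimes> r \<Longrightarrow> q = r"
  using P_subset Units_l_cancel[of p q r] by auto

lemma ql_le_left_mult:
  assumes "p \<in> carrier G" "q \<in> carrier G" "x \<in> carrier G"
  shows "ql_le G P (p \<otimes> q) (p \<otimes> x) \<longleftrightarrow> ql_le G P q x"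
proof -
  have "inv (p \<otimes> q) \<otimes> (p \<otimes> x) = inv q \<otimes> ((inv p \<otimes> p) \<otimes> x)"
    using assms by (simp only: inv_mult_group m_assoc inv_closed m_closed)
  then show ?thesis using assms by (simp add: ql_le_def)
qed

text \<open>
  An element of \<open>P\<close> above \<open>p \<otimes> q\<close> is \<open>p\<close> times an
  element above \<open>q\<close>, which lies in \<open>P\<close> because \<open>q\<close> does.
\<close>

lemma ql_ubs_left_mult:
  assumes "p \<in> P" "q \<in> P" "r \<in> P"
  shows "ql_ubs G P (p \<otimes> q) (p \<otimes> r) = (\<lambda>x. p \<otimes> x) ` ql_ubs G P q r"
proof -
  note C = assms[THEN subsetD[OF P_subset]]
  show ?thesis
  proof (intro equalityI subsetI)
    fix y assume y: "y \<in> ql_ubs G P (p \<otimes> q) (p \<otimes> r)"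
    then have yC: "y \<in> carrier G" using P_subset by (auto simp: ql_ubs_def)
    define x where "x = inv p \<otimes> y"
    have xC: "x \<in> carrier G" and y_eq: "y = p \<otimes> x"
      using C yC by (simp_all add: x_def flip: m_assoc)
    have le: "ql_le G P q x" "ql_le G P r x"
      using y C xC by (auto simp: y_eq ql_ubs_def ql_le_left_mult)
    have "x = q \<otimes> (inv q \<otimes> x)" using C xC by (simp flip: m_assoc)
    then have "x \<in> P" using le(1) assms(2) P_closed unfolding ql_le_def by metis
    then show "y \<in> (\<lambda>x. p \<otimes> x) ` ql_ubs G P q r" using le by (auto simp: ql_ubs_def y_eq)
  next
    fix y assume "y \<in> (\<lambda>x. p \<otimes> x) ` ql_ubs G P q r"
    then show "y \<in> ql_ubs G P (p \<otimes> q) (p \<otimes> r)"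
      using C P_subset P_closed assms(1) by (auto simp: ql_ubs_def ql_le_left_mult subset_iff)
  qed
qed

lemma ql_is_join_ql_join:
  assumes "p \<in> P" "q \<in> P" "ql_ubs G P p q \<noteq> {}"
  shows "ql_is_join G P p q (ql_join G P p q)"
  using join_exists assms P_subset ql_join_eqI by (metis subsetD)

lemma ql_join_in_P:
  assumes "p \<in> P" "q \<in> P" "ql_ubs G P p q \<noteq> {}"
  shows "ql_join G P p q \<in> P"
  using ql_is_join_ql_join[OF assms] by (simp add: ql_is_join_def ql_ubs_def)

lemma ql_join_left_mult:
  assumes "p \<in> P" "q \<in> P" "r \<in> P" "ql_ubs G P q r \<noteq> {}"
  shows "ql_join G P (p \<otimes> q) (p \<otimes> r) = p \<otimes> ql_join G P q r"
proof -
  obtain x where x: "ql_is_join G P q r x" using join_exists assms P_subset by blast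
  have "ql_le G P (p \<otimes> x) (p \<otimes> y)" if "y \<in> ql_ubs G P q r" for y
    using x that assms(1) P_subset
    by (subst ql_le_left_mult) (auto simp: ql_is_join_def ql_ubs_def subset_iff)
  then have "ql_is_join G P (p \<otimes> q) (p \<otimes> r) (p \<otimes> x)"
    using x by (auto simp: ql_is_join_def ql_ubs_left_mult assms)
  then show ?thesis using x by (simp add: ql_join_eqI)
qed

lemma ql_join_extension:
  assumes "p \<in> P" "q \<in> P"
  shows "p \<otimes> q \<in> ql_ubs G P p (p \<otimes> q)" "ql_join G P p (p \<otimes> q) = p \<otimes> q"
proof -
  have C: "p \<in> carrier G" "q \<in> carrier G" using assms P_subset by auto
  have "inv p \<otimes> (p \<otimes> q) = q" using C by (simp flip: m_assoc)
  then show ub: "p \<otimes> q \<in> ql_ubs G P p (p \<otimes> q)"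
    using assms C one_in_P P_closed by (simp add: ql_ubs_def ql_le_def)
  then show "ql_join G P p (p \<otimes> q) = p \<otimes> q"
    by (intro ql_join_eqI) (auto simp: ql_is_join_def ql_ubs_def)
qed

end

context P_graph
begin

text \<open>
  The uniqueness half of the factorisation property, without the reference to the morphism that is
  factored.
\<close>

lemma factor_unique:
  assumes "g \<in> mor L" "h \<in> mor L" "src L g = rng L h"
    and "g' \<in> mor L" "h' \<in> mor L" "src L g' = rng L h'"
    and "cmp L g h = cmp L g' h'" "d g = d g'" "d h = d h'"
  shows "g = g' \<and> h = h'"
proof -
  let ?Q = "\<lambda>(a, b). a \<in> mor L \<and> b \<in> mor L \<and> src L a = rng L b \<and>
    cmp L g h = cmp L a b \<and> d a = d g \<and> d b = d h"
  have "\<exists>!z. ?Q z"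
    using assms(1-3) cmp_mor d_in_P d_cmp by (intro factorisation) auto
  moreover have "?Q (g, h)" "?Q (g', h')" using assms by simp_all
  ultimately have "(g, h) = (g', h')" by blast
  then show ?thesis by simp
qed

lemma left_cancel:
  assumes "f \<in> mor L" "a \<in> mor L" "b \<in> mor L" "src L f = rng L a" "src L f = rng L b"
    "cmp L f a = cmp L f b"
  shows "a = b"
proof -
  have "d f \<otimes>\<^bsub>G\<^esub> d a = d f \<otimes>\<^bsub>G\<^esub> d b" using assms d_cmp by metis
  then have "d a = d b" using assms d_in_P left_cancel_P by metis
  then show ?thesis using factor_unique[of f a f b] assms by simp
qed

lemma degree_one:
  assumes "b \<in> mor L" "d b = \<one>\<^bsub>G\<^esub>" shows "b = idn L (rng L b)"
proof -
  have "idn L (rng L b) \<in> mor L" "idn L (src L b) \<in> mor L"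
    and "src L (idn L (rng L b)) = rng L b" "rng L (idn L (src L b)) = src L b"
    and "d (idn L (rng L b)) = \<one>\<^bsub>G\<^esub>" "d (idn L (src L b)) = \<one>\<^bsub>G\<^esub>"
    using assms rng_obj src_obj idn_mor src_idn rng_idn d_idn by auto
  then show ?thesis
    using factor_unique[of "idn L (rng L b)" b b "idn L (src L b)"] assms idn_left[of b] idn_right[of b]
    by simp
qed

lemma MCE_extension:
  assumes "f \<in> mor L" "a \<in> mor L" "src L f = rng L a"
  shows "MCE G P L d f (cmp L f a) = {cmp L f a}"
proof -
  let ?g = "cmp L f a"
  have g: "?g \<in> mor L" using assms cmp_mor by blast
  have dg: "d ?g = d f \<otimes>\<^bsub>G\<^esub> d a" using assms d_cmp by blast
  note join = ql_join_extension[OF d_in_P[OF assms(1)] d_in_P[OF assms(2)], folded dg]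
  have idn: "idn L (src L ?g) \<in> mor L" "rng L (idn L (src L ?g)) = src L ?g" "cmp L ?g (idn L (src L ?g)) = ?g"
    using g src_obj idn_mor rng_idn idn_right by auto
  show ?thesis
  proof (intro equalityI subsetI)
    fix h assume "h \<in> MCE G P L d f ?g"
    then obtain b where b: "b \<in> mor L" "src L ?g = rng L b" "h = cmp L ?g b" "d h = d ?g"
      unfolding MCE_def join(2) by blast
    then have "d ?g \<otimes>\<^bsub>G\<^esub> d b = d ?g" using g d_cmp by metis
    then have "d b = \<one>\<^bsub>G\<^esub>" using g b d_in_P P_subset by (metis l_cancel_one subsetD)
    then have "b = idn L (src L ?g)" using degree_one b by metis
    then show "h \<in> {?g}" using b idn by simp
  next
    fix h assume "h \<in> {?g}"
    then show "h \<in> MCE G P L d f ?g"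
      using assms g join idn unfolding MCE_def by (simp, metis empty_iff)
  qed
qed

text \<open>
  By left cancellation, the common extensions of \<open>f g\<close> and \<open>f h\<close> are those
  of \<open>g\<close> and \<open>h\<close> multiplied by \<open>f\<close>, and joins are invariant
  under left multiplication in the same way.
\<close>

lemma MCE_left_mult:
  assumes "f \<in> mor L" "g \<in> mor L" "h \<in> mor L" "src L f = rng L g" "src L f = rng L h"
  shows "MCE G P L d (cmp L f g) (cmp L f h) = left_mult L f (MCE G P L d g h)"
proof -
  note dP = assms(1-3)[THEN d_in_P]
  have dd: "d (cmp L f g) = d f \<otimes>\<^bsub>G\<^esub> d g" "d (cmp L f h) = d f \<otimes>\<^bsub>G\<^esub> d h" using assms d_cmp by auto
  have ne: "ql_ubs G P (d f \<otimes>\<^bsub>G\<^esub> d g) (d f \<otimes>\<^bsub>G\<^esub> d h) \<noteq> {} \<longleftrightarrow> ql_ubs G P (d g) (d h) \<noteq> {}"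
    by (simp add: ql_ubs_left_mult dP)
  show ?thesis
  proof (intro equalityI subsetI)
    fix k assume "k \<in> MCE G P L d (cmp L f g) (cmp L f h)"
    then obtain a b where k: "a \<in> mor L" "src L (cmp L f g) = rng L a" "k = cmp L (cmp L f g) a"
        "b \<in> mor L" "src L (cmp L f h) = rng L b" "k = cmp L (cmp L f h) b"
      and ubs: "ql_ubs G P (d g) (d h) \<noteq> {}" and dk: "d k = ql_join G P (d f \<otimes>\<^bsub>G\<^esub> d g) (d f \<otimes>\<^bsub>G\<^esub> d h)"
      unfolding MCE_def dd ne by blast
    have ab: "src L g = rng L a" "src L h = rng L b" using k assms src_cmp by auto
    have k': "k = cmp L f (cmp L g a)" "k = cmp L f (cmp L h b)"
      using k ab assms cmp_assoc by auto
    have M: "cmp L g a \<in> mor L" "cmp L h b \<in> mor L" "rng L (cmp L g a) = src L f" "rng L (cmp L h b) = src L f"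
      using k ab assms cmp_mor rng_cmp by auto
    then have eq: "cmp L g a = cmp L h b" using left_cancel[of f] k' assms by metis
    have "d f \<otimes>\<^bsub>G\<^esub> d (cmp L g a) = d f \<otimes>\<^bsub>G\<^esub> ql_join G P (d g) (d h)"
      using dk k'(1) M assms d_cmp ql_join_left_mult[OF dP ubs] by metis
    moreover have "ql_join G P (d g) (d h) \<in> P"
      using ql_join_in_P ubs dP by blast
    ultimately have "d (cmp L g a) = ql_join G P (d g) (d h)"
      using dP M(1) d_in_P left_cancel_P by metis
    then have "cmp L g a \<in> MCE G P L d g h"
      using M ubs k ab eq unfolding MCE_def by blast
    then show "k \<in> left_mult L f (MCE G P L d g h)"
      using k' M by (auto simp: left_mult_def)
  next
    fix k assume "k \<in> left_mult L f (MCE G P L d g h)"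
    then obtain k' a b where k: "k = cmp L f k'" "k' \<in> mor L" "ql_ubs G P (d g) (d h) \<noteq> {}"
      "d k' = ql_join G P (d g) (d h)" "a \<in> mor L" "b \<in> mor L" "src L g = rng L a"
      "src L h = rng L b" "k' = cmp L g a" "k' = cmp L h b" "rng L k' = src L f"
      unfolding left_mult_def MCE_def by blast
    have "k = cmp L (cmp L f g) a" "k = cmp L (cmp L f h) b"
      using k assms cmp_assoc by metis+
    moreover have "src L (cmp L f g) = rng L a" "src L (cmp L f h) = rng L b"
      using k assms src_cmp by auto
    moreover have "k \<in> mor L" using k assms cmp_mor by auto
    moreover have "d k = ql_join G P (d f \<otimes>\<^bsub>G\<^esub> d g) (d f \<otimes>\<^bsub>G\<^esub> d h)"
      using k assms d_cmp ql_join_left_mult[OF dP] by auto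
    ultimately show "k \<in> MCE G P L d (cmp L f g) (cmp L f h)"
      using k unfolding MCE_def dd ne by blast
  qed
qed

end

section \<open>Path categories\<close>

lemma path_cat_simps [simp]:
  "obj (path_cat E) = verts E" "rng (path_cat E) = fst" "idn (path_cat E) x = (x, [])"
  by (auto simp: path_cat_def)

lemma path_cat_src_cmp:
  "src (path_cat E) (x, es) = (if es = [] then x else tail E (last es))"
  "cmp (path_cat E) p q = (fst p, snd p @ snd q)"
  by (auto simp: path_cat_def split: prod.splits)

lemma Nil_path [simp]: "(x, []) \<in> mor (path_cat E) \<longleftrightarrow> x \<in> verts E"
  by (auto simp: path_cat_def)

lemma path_range: "p \<in> mor (path_cat E) \<Longrightarrow> fst p \<in> verts E"
  by (auto simp: path_cat_def)

context wf_digraph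
begin

lemma Cons_path:
  "(x, e # es) \<in> mor (path_cat G) \<longleftrightarrow>
     e \<in> arcs G \<and> head G e = x \<and> (tail G e, es) \<in> mor (path_cat G)"
  by (cases es) (auto simp: path_cat_def nth_Cons split: nat.splits)

lemma append_path:
  "(x, es @ fs) \<in> mor (path_cat G) \<longleftrightarrow>
     (x, es) \<in> mor (path_cat G) \<and> (src (path_cat G) (x, es), fs) \<in> mor (path_cat G)"
proof (induction es arbitrary: x)
  case Nil
  then show ?case using path_range[of "(x, fs)"] by (auto simp: path_cat_src_cmp)
next
  case (Cons e es)
  then show ?case by (auto simp: Cons_path path_cat_src_cmp)
qed

lemma cmp_path:
  assumes "p \<in> mor (path_cat G)" "q \<in> mor (path_cat G)" "src (path_cat G) p = fst q"
  shows "cmp (path_cat G) p q \<in> mor (path_cat G)"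
    "src (path_cat G) (cmp (path_cat G) p q) = src (path_cat G) q"
  using assms by (cases p; cases q; auto simp: append_path path_cat_src_cmp)+

lemma src_path: "p \<in> mor (path_cat G) \<Longrightarrow> src (path_cat G) p \<in> verts G"
  using append_path[of "fst p" "snd p" "[]"] by simp

text \<open>
  A path category has the factorisation property for the length, by cutting the list of edges;
  \<open>path_cancel\<close> below is the uniqueness.
\<close>

lemma path_factor:
  assumes "p \<in> mor (path_cat G)" "path_length p = m + n"
  obtains q r where "q \<in> mor (path_cat G)" "r \<in> mor (path_cat G)" "src (path_cat G) q = fst r"
    "p = cmp (path_cat G) q r" "path_length q = m" "path_length r = n"
proof -
  let ?q = "(fst p, take m (snd p))"
  \<comment> \<open>If \<open>?q\<close> contains no edge, its source is the range of \<open>p\<close>.\<close>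
  let ?r = "(src (path_cat G) ?q, drop m (snd p))"
  show ?thesis
    using that[of ?q ?r] assms append_path[of "fst p" "take m (snd p)" "drop m (snd p)"]
    by (simp add: path_length_def path_cat_src_cmp(2))
qed

end

lemma path_cancel:
  assumes "src (path_cat E) q = fst r" "src (path_cat E) q' = fst r'"
    "cmp (path_cat E) q r = cmp (path_cat E) q' r'" "path_length q = path_length q'"
  shows "q = q' \<and> r = r'"
  using assms by (cases q; cases r; cases q'; cases r') (auto simp: path_length_def path_cat_src_cmp)

lemma path_length_cmp:
  "path_length (cmp (path_cat E) p q) = path_length p + path_length q"
  by (simp add: path_length_def path_cat_src_cmp)

lemma countable_paths:
  assumes "countable (verts E)" "countable (arcs E)"
  shows "countable (mor (path_cat E))"
proof (rule countable_subset)
  show "mor (path_cat E) \<subseteq> verts E \<times> lists (arcs E)" by (auto simp: path_cat_def)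
qed (use assms in auto)

section \<open>The quasi-lattice ordered group of degrees\<close>

lemma Z2_simps [simp]:
  "carrier Z2 = UNIV" "\<one>\<^bsub>Z2\<^esub> = (0, 0)" "(a, b) \<otimes>\<^bsub>Z2\<^esub> (c, d) = (a + c, b + d)"
  by (simp_all add: Z2_def DirProd_def)

lemma group_Z2: "group Z2"
  by (simp add: Z2_def DirProd_group)

lemma inv_Z2 [simp]: "inv\<^bsub>Z2\<^esub> (a, b) = (- a, - b)"
  by (rule group.inv_equality[OF group_Z2]) auto

lemma quasi_lattice_Z: "quasi_lattice_ordered integer_group {0..}"
proof (rule group.quasi_lattice_orderedI)
  fix g x :: int assume "inv\<^bsub>integer_group\<^esub> g \<otimes>\<^bsub>integer_group\<^esub> x \<in> {0..}"
  show "\<exists>r \<in> {0..}. inv\<^bsub>integer_group\<^esub> g \<otimes>\<^bsub>integer_group\<^esub> r \<in> {0..} \<and>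
      (\<forall>x \<in> {0..}. inv\<^bsub>integer_group\<^esub> g \<otimes>\<^bsub>integer_group\<^esub> x \<in> {0..}
        \<longrightarrow> inv\<^bsub>integer_group\<^esub> r \<otimes>\<^bsub>integer_group\<^esub> x \<in> {0..})"
    by (intro bexI[of _ "max 0 g"]) auto
qed (auto simp: image_iff)

lemma quasi_lattice_Z2: "quasi_lattice_ordered Z2 ({0..} \<times> {0..})"
proof (rule group.quasi_lattice_orderedI[OF group_Z2])
  fix g x :: "int \<times> int"
  obtain a b where g: "g = (a, b)" by (cases g)
  show "\<exists>r \<in> {0..} \<times> {0..}. inv\<^bsub>Z2\<^esub> g \<otimes>\<^bsub>Z2\<^esub> r \<in> {0..} \<times> {0..} \<and>
      (\<forall>x \<in> {0..} \<times> {0..}. inv\<^bsub>Z2\<^esub> g \<otimes>\<^bsub>Z2\<^esub> x \<in> {0..} \<times> {0..}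
        \<longrightarrow> inv\<^bsub>Z2\<^esub> r \<otimes>\<^bsub>Z2\<^esub> x \<in> {0..} \<times> {0..})"
    unfolding g by (intro bexI[of _ "(max 0 a, max 0 b)"]) auto
qed (force simp: image_iff)+

interpretation deg: ql_pair Z2 "{0..} \<times> {0..}" integer_group "{0..}"
  rewrites "free_product Z2 integer_group = Z2_free_Z"
    and "fp_submonoid Z2 ({0..} \<times> {0..}) integer_group {0..} = N2_free_N"
  by (auto simp: ql_pair_def group_pair_def quasi_lattice_Z quasi_lattice_Z2 group_Z2
      Z2_free_Z_def N2_free_N_def)

section \<open>Segments\<close>

lemma fst_cmp_path: "fst (cmp (path_cat E) p q) = fst p"
  by (simp add: path_cat_src_cmp)

lemma is_DS_iff: "is_DS s \<longleftrightarrow> (\<exists>p. s = DS p)"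
  by (cases s) auto

text \<open>
  The degree of a segment as a syllable, which is trivial for a vertex; the degree as a word is its
  image under \<open>deg.emb\<close>.
\<close>

fun seg_syl :: "('v, 'e, 'w, 'f) seg \<Rightarrow> int \<times> int + int" where
  "seg_syl (DS p) = Inr (int (path_length p))"
| "seg_syl (CS i (a, b)) = Inl (int (path_length a), int (path_length b))"

lemma seg_degree_eq: "seg_degree s = deg.emb (seg_syl s)"
  by (cases s rule: seg_syl.cases) (auto simp: deg.emb_def fp_inl_def fp_inr_def)

lemma isl_seg_syl [simp]: "isl (seg_syl s) \<longleftrightarrow> \<not> is_DS s"
  by (cases s rule: seg_syl.cases) auto

lemma pos_seg_syl [simp]: "deg.pos (seg_syl s)"
  by (cases s rule: seg_syl.cases) auto

lemma triv_seg_syl [simp]: "deg.triv (seg_syl s) \<longleftrightarrow> seg_is_vertex s"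
  by (cases s rule: seg_syl.cases) auto

interpretation D: wf_digraph Dgraph
  by standard (auto simp: Dgraph_def)

lemma two_graph_simps [simp]:
  "obj (two_graph E F i) = verts (E i) \<times> verts (F i)"
  "mor (two_graph E F i) = mor (path_cat (E i)) \<times> mor (path_cat (F i))"
  "rng (two_graph E F i) (a, b) = (fst a, fst b)"
  "src (two_graph E F i) (a, b) = (src (path_cat (E i)) a, src (path_cat (F i)) b)"
  "idn (two_graph E F i) (x, y) = ((x, []), (y, []))"
  "cmp (two_graph E F i) (a, b) (a', b') = (cmp (path_cat (E i)) a a', cmp (path_cat (F i)) b b')"
  by (auto simp: two_graph_def product_cat_def)

text \<open>
  Although \<open>u\<^sub>i\<close> has two names, no two vertices of the 2-graphs are identified
  with each other.
\<close>

lemma glue_inject [simp]: "glue v w i z = glue v w j z' \<longleftrightarrow> i = j \<and> z = z'"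
  by (auto simp: glue_def prod_eq_iff)

locale hybrid_graph =
  fixes E :: "ix \<Rightarrow> ('v, 'e) pre_digraph" and F :: "ix \<Rightarrow> ('w, 'f) pre_digraph"
    and v :: "ix \<Rightarrow> 'v" and w :: "ix \<Rightarrow> 'w"
  assumes wf_E: "wf_digraph (E i)" and wf_F: "wf_digraph (F i)"
    and countable_E: "countable (verts (E i))" "countable (arcs (E i))"
    and countable_F: "countable (verts (F i))" "countable (arcs (F i))"
    and base_E: "v i \<in> verts (E i)" and base_F: "w i \<in> verts (F i)"
begin

abbreviation "SR \<equiv> seg_rng E F v w"
abbreviation "SS \<equiv> seg_src E F v w"
abbreviation "Seg \<equiv> segments E F"
abbreviation "scmp \<equiv> seg_cmp E F"

definition composable :: "('v, 'e, 'w, 'f) seg \<Rightarrow> ('v, 'e, 'w, 'f) seg \<Rightarrow> bool" where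
  "composable s t \<longleftrightarrow> s \<in> Seg \<and> t \<in> Seg \<and> is_DS s = is_DS t \<and> SS s = SR t"

lemma seg_cases [consumes 1, case_names D C]:
  assumes "s \<in> Seg"
  obtains (D) p where "s = DS p" "p \<in> mor (path_cat Dgraph)"
  | (C) i a b where "s = CS i (a, b)" "a \<in> mor (path_cat (E i))" "b \<in> mor (path_cat (F i))"
  using assms unfolding segments_def by auto

lemma DS_seg [simp]: "DS p \<in> Seg \<longleftrightarrow> p \<in> mor (path_cat Dgraph)"
  by (auto simp: segments_def)

lemma CS_seg [simp]:
  "CS i (a, b) \<in> Seg \<longleftrightarrow> a \<in> mor (path_cat (E i)) \<and> b \<in> mor (path_cat (F i))"
  by (auto simp: segments_def)

text \<open>
  Segments of the same type that can be composed lie in \<open>D\<close> or in the same 2-graph: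
  since \<open>glue\<close> is injective, the end points determine the index and the vertices of the
  two coordinates.
\<close>

lemma composable_cases [consumes 1, case_names D C]:
  assumes "composable s t"
  obtains (D) p q where "s = DS p" "t = DS q" "p \<in> mor (path_cat Dgraph)"
      "q \<in> mor (path_cat Dgraph)" "src (path_cat Dgraph) p = fst q"
  | (C) i a b a' b' where "s = CS i (a, b)" "t = CS i (a', b')"
      "a \<in> mor (path_cat (E i))" "b \<in> mor (path_cat (F i))"
      "a' \<in> mor (path_cat (E i))" "b' \<in> mor (path_cat (F i))"
      "src (path_cat (E i)) a = fst a'" "src (path_cat (F i)) b = fst b'"
proof -
  have st: "s \<in> Seg" "t \<in> Seg" "is_DS s = is_DS t" "SS s = SR t"
    using assms by (auto simp: composable_def)
  from st(1) show ?thesis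
  proof (cases rule: seg_cases)
    case (D p)
    from st(2) show ?thesis
      by (cases rule: seg_cases) (use D st in \<open>auto intro: that(1)\<close>)
  next
    case (C i a b)
    from st(2) show ?thesis
      by (cases rule: seg_cases) (use C st in \<open>auto intro: that(2)\<close>)
  qed
qed

lemma seg_cmp_props:
  assumes "composable s t"
  shows "scmp s t \<in> Seg" "is_DS (scmp s t) = is_DS s" "SR (scmp s t) = SR s"
    "SS (scmp s t) = SS t" "seg_syl (scmp s t) = deg.smul (seg_syl s) (seg_syl t)"
  using assms
  by (cases rule: composable_cases;
      auto simp: D.cmp_path wf_digraph.cmp_path[OF wf_E] wf_digraph.cmp_path[OF wf_F]
        path_length_cmp fst_cmp_path)+

lemma seg_cmp_vertex:
  "composable s t \<Longrightarrow> seg_is_vertex (scmp s t) \<longleftrightarrow> seg_is_vertex s \<and> seg_is_vertex t"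
  using deg.triv_smul_pos[of "seg_syl s" "seg_syl t"] seg_cmp_props(5)[of s t]
  by (auto simp: composable_def simp flip: triv_seg_syl)

lemma seg_cmp_assoc:
  assumes "composable s t" "composable t r"
  shows "scmp (scmp s t) r = scmp s (scmp t r)"
  using assms(1)
proof (cases rule: composable_cases)
  case (D p q)
  from assms(2) show ?thesis
    by (cases rule: composable_cases) (use D in \<open>auto simp: path_cat_src_cmp\<close>)
next
  case (C i a b a' b')
  from assms(2) show ?thesis
    by (cases rule: composable_cases) (use C in \<open>auto simp: path_cat_src_cmp\<close>)
qed

text \<open>
  Segments inherit the factorisation property from path categories, coordinatewise in the case of a
  2-graph; \<open>seg_cancel\<close> below is the uniqueness.
\<close>

lemma seg_factor:
  assumes "s \<in> Seg" "seg_syl s = deg.smul x y" "deg.pos x" "deg.pos y" "isl x = isl y"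
  obtains s1 s2 where "composable s1 s2" "s = scmp s1 s2" "seg_syl s1 = x" "seg_syl s2 = y"
  using assms(1)
proof (cases rule: seg_cases)
  case (D p)
  then obtain m n where xy: "x = Inr (int m)" "y = Inr (int n)"
    using assms(2-5) by (cases x; cases y) (auto dest!: zero_le_imp_eq_int)
  then have "path_length p = m + n" using assms(2) D by (simp flip: of_nat_add)
  from D.path_factor[OF D(2) this] obtain q r where
    "q \<in> mor (path_cat Dgraph)" "r \<in> mor (path_cat Dgraph)" "src (path_cat Dgraph) q = fst r"
    "p = cmp (path_cat Dgraph) q r" "path_length q = m" "path_length r = n" .
  then show ?thesis using that[of "DS q" "DS r"] D xy by (auto simp: composable_def)
next
  case (C i a b)
  then obtain m n m' n' where xy: "x = Inl (int m, int m')" "y = Inl (int n, int n')"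
    using assms(2-5) by (cases x; cases y) (auto dest!: zero_le_imp_eq_int)
  then have ab: "path_length a = m + n" "path_length b = m' + n'"
    using assms(2) C by (simp_all flip: of_nat_add)
  from wf_digraph.path_factor[OF wf_E C(2) ab(1)] obtain q r where
    "q \<in> mor (path_cat (E i))" "r \<in> mor (path_cat (E i))" "src (path_cat (E i)) q = fst r"
    "a = cmp (path_cat (E i)) q r" "path_length q = m" "path_length r = n" .
  moreover from wf_digraph.path_factor[OF wf_F C(3) ab(2)] obtain q' r' where
    "q' \<in> mor (path_cat (F i))" "r' \<in> mor (path_cat (F i))" "src (path_cat (F i)) q' = fst r'"
    "b = cmp (path_cat (F i)) q' r'" "path_length q' = m'" "path_length r' = n'" .
  ultimately show ?thesis
    using that[of "CS i (q, q')" "CS i (r, r')"] C xy by (auto simp: composable_def)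
qed

lemma seg_cancel:
  assumes "composable s t" "composable s' t'" "scmp s t = scmp s' t'" "seg_syl s = seg_syl s'"
  shows "s = s' \<and> t = t'"
  using assms(1)
proof (cases rule: composable_cases)
  case (D p q)
  from assms(2) show ?thesis
  proof (cases rule: composable_cases)
    case (D p' q')
    then show ?thesis using \<open>s = DS p\<close> \<open>t = DS q\<close> \<open>src _ p = fst q\<close> assms path_cancel[of Dgraph p q p' q']
      by auto
  qed (use D assms in auto)
next
  case C: (C i a b c d)
  from assms(2) show ?thesis
  proof (cases rule: composable_cases)
    case (C i' a' b' c' d')
    then show ?thesis using \<open>s = CS i (a, b)\<close> \<open>t = CS i (c, d)\<close> \<open>src _ a = fst c\<close> \<open>src _ b = fst d\<close> assms
        path_cancel[of "E i" a c a' c'] path_cancel[of "F i" b d b' d']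
      by auto
  qed (use C assms in auto)
qed

lemma countable_Seg: "countable Seg"
proof -
  have "UNIV = {I0, I1}" using ix.exhaust by auto
  then have ix: "finite (UNIV :: ix set)" by (metis finite.emptyI finite.insertI)
  have dv: "finite (UNIV :: dvert set)"
  proof (rule finite_subset)
    show "UNIV \<subseteq> VU ` UNIV \<union> VA ` UNIV" using dvert.exhaust by blast
  qed (use ix in simp)
  moreover have "finite (UNIV :: dedge set)"
  proof (rule finite_subset)
    show "UNIV \<subseteq> UA ` UNIV \<union> AU ` UNIV \<union> UU ` UNIV \<union> (\<lambda>(i, b). AA i b) ` (UNIV \<times> UNIV)"
    proof
      show "e \<in> UA ` UNIV \<union> AU ` UNIV \<union> UU ` UNIV \<union> (\<lambda>(i, b). AA i b) ` (UNIV \<times> UNIV)" for e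
        by (cases e) (auto simp: image_iff)
    qed
  qed (intro finite_UnI finite_imageI finite_cartesian_product ix finite)
  ultimately have "countable (UNIV :: dvert set)" "countable (UNIV :: dedge set)" "countable (UNIV :: ix set)"
    using ix by (auto intro: countable_finite)
  then show ?thesis
    unfolding segments_def
    by (intro countable_Un countable_image countable_UN)
      (auto intro!: countable_paths countable_SIGMA simp: countable_E countable_F Dgraph_def)
qed

section \<open>The category of finite paths\<close>

abbreviation "H \<equiv> hybrid E F v w"
abbreviation "pcmp \<equiv> path_cmp E F"
abbreviation "vpath \<equiv> vertex_path E F"

lemma hybrid_simps [simp]:
  "mor H = finite_paths E F v w" "rng H \<mu> = SR (hd \<mu>)" "src H \<mu> = SS (last \<mu>)"
  "idn H = vpath" "cmp H = pcmp"
  by (simp_all add: hybrid_def)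

definition adj :: "('v, 'e, 'w, 'f) seg \<Rightarrow> ('v, 'e, 'w, 'f) seg \<Rightarrow> bool" where
  "adj s t \<longleftrightarrow> SS s = SR t \<and> is_DS s \<noteq> is_DS t"

text \<open>
  The finite paths other than vertices: strings of nontrivial segments of alternating types.
  Splitting \<open>finite_paths\<close> into these and the vertices, as in \<open>mor_iff\<close>
  below, separates the strings on which composition is concatenation, with at most one merging, from
  the identities.
\<close>

definition proper :: "('v, 'e, 'w, 'f) hpath set" where
  "proper = {\<mu>. \<mu> \<noteq> [] \<and> set \<mu> \<subseteq> {s \<in> Seg. \<not> seg_is_vertex s} \<and> successively adj \<mu>}"

lemma object_cases [consumes 1, case_names D C]:
  assumes "x \<in> obj H"
  obtains (D) y where "x = DV y"
  | (C) i a b where "x = CV i a b" "x = glue v w i (a, b)" "(a, b) \<noteq> (v i, w i)"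
      "a \<in> verts (E i)" "b \<in> verts (F i)"
proof -
  from assms consider (1) y where "x = DV y"
    | (2) i a b where "x = glue v w i (a, b)" "a \<in> verts (E i)" "b \<in> verts (F i)"
    unfolding hybrid_def by auto
  then show ?thesis
  proof cases
    case 2
    then show ?thesis
      using D[of "VU i"] C[of i a b] by (cases "(a, b) = (v i, w i)") (auto simp: glue_def)
  qed (rule D)
qed

lemma vpath_object:
  assumes "x \<in> obj H"
  obtains s where "vpath x = [s]" "s \<in> Seg" "seg_is_vertex s" "SR s = x" "SS s = x"
    "\<And>i. s \<noteq> CS i (idn (two_graph E F i) (v i, w i))"
  using assms
proof (cases rule: object_cases)
  case (D y)
  then show ?thesis
    using that[of "DS (y, [])"] by (simp add: path_length_def path_cat_src_cmp Dgraph_def)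
next
  case (C i a b)
  then show ?thesis
    using that[of "CS i ((a, []), (b, []))"] by (auto simp: path_length_def path_cat_src_cmp)
qed

lemma vertex_segment:
  assumes "s \<in> Seg" "seg_is_vertex s" "\<And>i. s \<noteq> CS i (idn (two_graph E F i) (v i, w i))"
  shows "SR s \<in> obj H \<and> [s] = vpath (SR s)"
  using assms(1)
proof (cases rule: seg_cases)
  case (D p)
  then show ?thesis
    using assms(2) path_range[of p Dgraph]
    by (cases p) (auto simp: hybrid_def path_length_def)
next
  case (C i a b)
  then obtain x y where xy: "a = (x, [])" "b = (y, [])"
    using assms(2) by (cases a; cases b) (auto simp: path_length_def)
  have "(x, y) \<noteq> (v i, w i)" using assms(3)[of i] C xy by auto
  then have "glue v w i (x, y) = CV i x y" unfolding glue_def by simp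
  moreover have "glue v w i (x, y) \<in> obj H"
    using C xy unfolding hybrid_def by auto
  ultimately show ?thesis using C xy by simp
qed

lemma mor_iff: "\<mu> \<in> mor H \<longleftrightarrow> \<mu> \<in> proper \<or> (\<exists>x \<in> obj H. \<mu> = vpath x)"
proof
  assume \<mu>: "\<mu> \<in> mor H"
  show "\<mu> \<in> proper \<or> (\<exists>x \<in> obj H. \<mu> = vpath x)"
  proof (cases "\<exists>s \<in> set \<mu>. seg_is_vertex s")
    case True
    then have "\<not> length \<mu> > 1" "\<mu> \<noteq> []" using \<mu> by (auto simp: finite_paths_def)
    then obtain s where s: "\<mu> = [s]" by (cases \<mu>; cases "tl \<mu>") auto
    then show ?thesis
      using vertex_segment[of s] True \<mu> by (auto simp: finite_paths_def)
  next
    case False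
    then show ?thesis
      using \<mu> by (auto simp: finite_paths_def proper_def successively_conv_nth adj_def)
  qed
next
  assume "\<mu> \<in> proper \<or> (\<exists>x \<in> obj H. \<mu> = vpath x)"
  then show "\<mu> \<in> mor H"
  proof
    assume "\<mu> \<in> proper"
    moreover have "seg_is_vertex (CS i (idn (two_graph E F i) (v i, w i)))" for i
      by (simp add: path_length_def)
    ultimately show ?thesis
      unfolding hybrid_simps finite_paths_def proper_def successively_conv_nth adj_def by blast
  next
    assume "\<exists>x \<in> obj H. \<mu> = vpath x"
    then obtain x where "x \<in> obj H" "\<mu> = vpath x" by blast
    then show ?thesis
      by (elim vpath_object) (auto simp: finite_paths_def)
  qed
qed

lemma mor_cases [consumes 1, case_names vertex proper]:
  assumes "\<mu> \<in> mor H"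
  obtains x where "x \<in> obj H" "\<mu> = vpath x" | "\<mu> \<in> proper"
  using assms mor_iff by blast

lemma proper_mor: "\<mu> \<in> proper \<Longrightarrow> \<mu> \<in> finite_paths E F v w"
  using mor_iff by simp

lemma vpath_mor: "x \<in> obj H \<Longrightarrow> vpath x \<in> finite_paths E F v w"
  using mor_iff[of "vpath x"] by auto

lemma is_vertex_vpath [simp]: "is_vertex_path (vpath x)"
  by (cases x) (auto simp: is_vertex_path_def path_length_def)

lemma proper_not_vertex: "\<mu> \<in> proper \<Longrightarrow> \<not> is_vertex_path \<mu>"
  by (auto simp: proper_def is_vertex_path_def)

lemma vpath_ends: "x \<in> obj H \<Longrightarrow> SR (hd (vpath x)) = x" "x \<in> obj H \<Longrightarrow> SS (last (vpath x)) = x"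
  by (auto elim!: vpath_object)

lemma length_vpath [simp]: "length (vpath x) = 1"
  by (cases x) auto

lemma seg_ends_obj:
  assumes "s \<in> Seg" shows "SR s \<in> obj H \<and> SS s \<in> obj H"
  using assms
proof (cases rule: seg_cases)
  case (D p)
  have "DV x \<in> obj H" for x by (simp add: hybrid_def Dgraph_def)
  then show ?thesis using D by simp
next
  case (C i a b)
  have "glue v w i z \<in> obj H" if "z \<in> verts (E i) \<times> verts (F i)" for z
    using that unfolding hybrid_def two_graph_simps by auto
  then show ?thesis
    using C wf_digraph.src_path[OF wf_E C(2)] wf_digraph.src_path[OF wf_F C(3)]
      path_range[OF C(2)] path_range[OF C(3)] by simp
qed

lemma proper_snoc: "\<mu> @ [s] \<in> proper \<longleftrightarrow>
    s \<in> Seg \<and> \<not> seg_is_vertex s \<and> (\<mu> = [] \<or> \<mu> \<in> proper \<and> adj (last \<mu>) s)"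
  by (auto simp: proper_def successively_append_iff)

lemma proper_Cons: "s # \<mu> \<in> proper \<longleftrightarrow>
    s \<in> Seg \<and> \<not> seg_is_vertex s \<and> (\<mu> = [] \<or> \<mu> \<in> proper \<and> adj s (hd \<mu>))"
  by (cases \<mu>) (auto simp: proper_def)

lemma proper_append: "\<mu> \<noteq> [] \<Longrightarrow> \<nu> \<noteq> [] \<Longrightarrow>
    \<mu> @ \<nu> \<in> proper \<longleftrightarrow> \<mu> \<in> proper \<and> \<nu> \<in> proper \<and> adj (last \<mu>) (hd \<nu>)"
  by (auto simp: proper_def successively_append_iff)

lemma pcmp_vpath_left [simp]: "pcmp (vpath x) \<nu> = \<nu>"
  by (simp add: path_cmp_def)

lemma pcmp_vpath_right: "\<mu> \<in> proper \<Longrightarrow> pcmp \<mu> (vpath x) = \<mu>"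
  by (simp add: path_cmp_def proper_not_vertex)

lemma pcmp_vertex_right:
  assumes "\<mu> \<in> mor H" "x \<in> obj H" "src H \<mu> = x"
  shows "pcmp \<mu> (vpath x) = \<mu>"
  using assms(1) by (cases rule: mor_cases) (use assms vpath_ends in \<open>auto simp: pcmp_vpath_right\<close>)

lemma pcmp_proper:
  assumes "\<mu> @ [s] \<in> proper" "t # \<nu> \<in> proper"
  shows "pcmp (\<mu> @ [s]) (t # \<nu>) =
    (if is_DS s = is_DS t then \<mu> @ [scmp s t] @ \<nu> else \<mu> @ [s, t] @ \<nu>)"
  using assms[THEN proper_not_vertex] by (auto simp: path_cmp_def)

lemma proper_snocE:
  assumes "\<mu> \<in> proper" obtains \<mu>' s where "\<mu> = \<mu>' @ [s]"
  using assms by (cases \<mu> rule: rev_cases) (auto simp: proper_def)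

lemma proper_ConsE:
  assumes "\<mu> \<in> proper" obtains \<mu>' s where "\<mu> = s # \<mu>'"
  using assms by (cases \<mu>) (auto simp: proper_def)

lemma adj_scmp_left: "composable s t \<Longrightarrow> adj (scmp s t) r \<longleftrightarrow> adj t r"
  by (auto simp: adj_def seg_cmp_props) (auto simp: composable_def)

lemma adj_scmp_right: "composable s t \<Longrightarrow> adj r (scmp s t) \<longleftrightarrow> adj r s"
  by (auto simp: adj_def seg_cmp_props)

lemma pcmp_proper_props:
  assumes "\<mu> \<in> proper" "\<nu> \<in> proper" "src H \<mu> = rng H \<nu>"
  shows "pcmp \<mu> \<nu> \<in> proper" "rng H (pcmp \<mu> \<nu>) = rng H \<mu>" "src H (pcmp \<mu> \<nu>) = src H \<nu>"
proof -
  obtain \<mu>' s where \<mu>: "\<mu> = \<mu>' @ [s]" using proper_snocE assms(1) by blast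
  obtain t \<nu>' where \<nu>: "\<nu> = t # \<nu>'" using proper_ConsE assms(2) by blast
  have eq: "SS s = SR t" using assms(3) by (simp add: \<mu> \<nu>)
  have st: "s \<in> Seg" "\<not> seg_is_vertex s" "t \<in> Seg" "\<not> seg_is_vertex t"
    using assms by (auto simp: \<mu> \<nu> proper_snoc proper_Cons)
  have "pcmp \<mu> \<nu> \<in> proper \<and> rng H (pcmp \<mu> \<nu>) = rng H \<mu> \<and> src H (pcmp \<mu> \<nu>) = src H \<nu>"
  proof (cases "is_DS s = is_DS t")
    case True
    then have c: "composable s t" using st eq by (simp add: composable_def)
    have "pcmp \<mu> \<nu> = \<mu>' @ scmp s t # \<nu>'" using True assms by (simp add: \<mu> \<nu> pcmp_proper)
    moreover have "\<mu>' @ scmp s t # \<nu>' \<in> proper"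
      using assms c seg_cmp_props(1)[OF c] st
      by (cases "\<mu>' = []") (auto simp: \<mu> \<nu> proper_snoc proper_Cons proper_append seg_cmp_vertex
          adj_scmp_left adj_scmp_right)
    ultimately show ?thesis
      using c by (simp add: \<mu> \<nu> hd_append seg_cmp_props)
  next
    case False
    then have "pcmp \<mu> \<nu> = \<mu> @ \<nu>" using assms by (simp add: \<mu> \<nu> pcmp_proper)
    moreover have "\<mu> @ \<nu> \<in> proper"
      using assms False eq by (subst proper_append) (auto simp: \<mu> \<nu> adj_def)
    ultimately show ?thesis by (simp add: \<mu> \<nu> hd_append)
  qed
  then show "pcmp \<mu> \<nu> \<in> proper" "rng H (pcmp \<mu> \<nu>) = rng H \<mu>" "src H (pcmp \<mu> \<nu>) = src H \<nu>"
    by auto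
qed

text \<open>
  The two mergings, at the left and at the right end of \<open>\<nu>\<close>, do not interfere if
  \<open>\<nu>\<close> has at least two segments. If \<open>\<nu>\<close> is a single segment, both
  may involve it, and the claim is associativity of the composition of segments.
\<close>

lemma pcmp_assoc_proper:
  assumes "\<mu> \<in> proper" "\<nu> \<in> proper" "\<rho> \<in> proper" "src H \<mu> = rng H \<nu>" "src H \<nu> = rng H \<rho>"
  shows "pcmp (pcmp \<mu> \<nu>) \<rho> = pcmp \<mu> (pcmp \<nu> \<rho>)"
proof -
  obtain \<mu>' s where \<mu>: "\<mu> = \<mu>' @ [s]" using proper_snocE assms(1) by blast
  obtain r \<rho>' where \<rho>: "\<rho> = r # \<rho>'" using proper_ConsE assms(3) by blast
  have nv: "\<not> is_vertex_path \<mu>" "\<not> is_vertex_path \<nu>" "\<not> is_vertex_path \<rho>"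
      "\<not> is_vertex_path (pcmp \<mu> \<nu>)" "\<not> is_vertex_path (pcmp \<nu> \<rho>)"
    using assms pcmp_proper_props by (auto intro!: proper_not_vertex)
  have Seg: "s \<in> Seg" "r \<in> Seg" "\<nu> \<noteq> []" "set \<nu> \<subseteq> Seg"
    using assms by (auto simp: \<mu> \<rho> proper_snoc proper_Cons proper_def)
  show ?thesis
  proof (cases "\<exists>t. \<nu> = [t]")
    case True
    then obtain t where \<nu>: "\<nu> = [t]" by blast
    have st: "composable s t" if "is_DS s = is_DS t"
      using that Seg assms by (auto simp: composable_def \<mu> \<nu>)
    have tr: "composable t r" if "is_DS t = is_DS r"
      using that Seg assms by (auto simp: composable_def \<rho> \<nu>)
    show ?thesis
    proof (cases "is_DS s = is_DS t"; cases "is_DS t = is_DS r")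
      assume *: "is_DS s = is_DS t" "is_DS t = is_DS r"
      then show ?thesis using nv st tr
        by (simp add: path_cmp_def \<mu> \<nu> \<rho> seg_cmp_props seg_cmp_assoc)
    next
      assume *: "is_DS s = is_DS t" "is_DS t \<noteq> is_DS r"
      then show ?thesis using nv st
        by (simp add: path_cmp_def \<mu> \<nu> \<rho> seg_cmp_props butlast_append)
    next
      assume *: "is_DS s \<noteq> is_DS t" "is_DS t = is_DS r"
      then show ?thesis using nv tr
        by (simp add: path_cmp_def \<mu> \<nu> \<rho> seg_cmp_props butlast_append)
    next
      assume *: "is_DS s \<noteq> is_DS t" "is_DS t \<noteq> is_DS r"
      then show ?thesis using nv
        by (simp add: path_cmp_def \<mu> \<nu> \<rho> butlast_append)
    qed
  next
    case False
    then obtain t \<nu>' t' where \<nu>: "\<nu> = t # \<nu>' @ [t']"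
      using \<open>\<nu> \<noteq> []\<close> by (metis append_Cons append_Nil neq_Nil_conv rev_exhaust)
    define st where "st = (if is_DS s = is_DS t then [scmp s t] else [s, t])"
    define tr where "tr = (if is_DS t' = is_DS r then [scmp t' r] else [t', r])"
    have \<mu>\<nu>: "pcmp \<mu> \<nu> = \<mu>' @ st @ \<nu>' @ [t']"
      using nv(1,2) by (simp add: path_cmp_def \<mu> \<nu> st_def)
    have \<nu>\<rho>: "pcmp \<nu> \<rho> = t # \<nu>' @ tr @ \<rho>'"
      using nv(2,3) by (simp add: path_cmp_def \<nu> \<rho> tr_def butlast_append)
    have "pcmp (pcmp \<mu> \<nu>) \<rho> = \<mu>' @ st @ \<nu>' @ tr @ \<rho>'"
      using nv(3,4) unfolding \<mu>\<nu> by (simp add: path_cmp_def \<rho> tr_def butlast_append)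
    moreover have "pcmp \<mu> (pcmp \<nu> \<rho>) = \<mu>' @ st @ \<nu>' @ tr @ \<rho>'"
      using nv(1,5) unfolding \<nu>\<rho> by (simp add: path_cmp_def \<mu> st_def)
    ultimately show ?thesis by simp
  qed
qed

lemma pcmp_props:
  assumes "\<mu> \<in> mor H" "\<nu> \<in> mor H" "src H \<mu> = rng H \<nu>"
  shows "pcmp \<mu> \<nu> \<in> mor H" "rng H (pcmp \<mu> \<nu>) = rng H \<mu>" "src H (pcmp \<mu> \<nu>) = src H \<nu>"
proof -
  have "pcmp \<mu> \<nu> \<in> mor H \<and> rng H (pcmp \<mu> \<nu>) = rng H \<mu> \<and> src H (pcmp \<mu> \<nu>) = src H \<nu>"
    using assms(1)
  proof (cases rule: mor_cases)
    case (vertex x)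
    then show ?thesis using assms by (auto simp: vpath_ends)
  next
    case proper
    note \<mu> = this
    from assms(2) show ?thesis
    proof (cases rule: mor_cases)
      case (vertex x)
      then show ?thesis using assms by (auto simp: vpath_ends pcmp_vpath_right \<mu>)
    next
      case proper
      then show ?thesis using pcmp_proper_props[OF \<mu> proper assms(3)] proper_mor by auto
    qed
  qed
  then show "pcmp \<mu> \<nu> \<in> mor H" "rng H (pcmp \<mu> \<nu>) = rng H \<mu>" "src H (pcmp \<mu> \<nu>) = src H \<nu>"
    by auto
qed

theorem hybrid_category: "small_category H"
proof
  fix \<mu> assume \<mu>: "\<mu> \<in> mor H"
  have "set \<mu> \<subseteq> Seg" "\<mu> \<noteq> []" using \<mu> by (auto simp: finite_paths_def)
  then have "hd \<mu> \<in> Seg" "last \<mu> \<in> Seg" by auto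
  then show obj: "rng H \<mu> \<in> obj H" "src H \<mu> \<in> obj H" by (simp_all add: seg_ends_obj)
  show "cmp H (idn H (rng H \<mu>)) \<mu> = \<mu>" by simp
  show "cmp H \<mu> (idn H (src H \<mu>)) = \<mu>" using pcmp_vertex_right[OF \<mu> obj(2)] by simp
  fix \<nu> assume \<nu>: "\<nu> \<in> mor H" and \<mu>\<nu>: "src H \<mu> = rng H \<nu>"
  show "cmp H \<mu> \<nu> \<in> mor H" "rng H (cmp H \<mu> \<nu>) = rng H \<mu>" "src H (cmp H \<mu> \<nu>) = src H \<nu>"
    using pcmp_props[OF \<mu> \<nu> \<mu>\<nu>] by simp_all
  fix \<rho> assume \<rho>: "\<rho> \<in> mor H" and \<nu>\<rho>: "src H \<nu> = rng H \<rho>"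
  have "pcmp (pcmp \<mu> \<nu>) \<rho> = pcmp \<mu> (pcmp \<nu> \<rho>)"
    using \<mu>
  proof (cases rule: mor_cases)
    case p1: proper
    from \<nu> show ?thesis
    proof (cases rule: mor_cases)
      case p2: proper
      from \<rho> show ?thesis
      proof (cases rule: mor_cases)
        case (vertex x)
        then show ?thesis
          using pcmp_proper_props[OF p1 p2 \<mu>\<nu>] p2 by (simp add: pcmp_vpath_right)
      next
        case proper
        show ?thesis by (rule pcmp_assoc_proper[OF p1 p2 proper \<mu>\<nu> \<nu>\<rho>])
      qed
    qed (use p1 in \<open>simp add: pcmp_vpath_right\<close>)
  qed simp
  then show "cmp H (cmp H \<mu> \<nu>) \<rho> = cmp H \<mu> (cmp H \<nu> \<rho>)" by simp
qed (auto simp: vpath_mor vpath_ends)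

lemma countable_hybrid: "countable (mor H)"
proof (rule countable_subset)
  show "mor H \<subseteq> lists Seg" by (auto simp: finite_paths_def)
qed (rule countable_lists[OF countable_Seg])

section \<open>Degrees and the factorisation property\<close>

lemma degree_vpath: "hybrid_degree (vpath x) = []"
  by (cases x) (auto simp: hybrid_degree_def seg_degree_eq deg.emb_def path_length_def)

lemma proper_words: "\<mu> \<in> proper \<Longrightarrow> map seg_syl \<mu> \<in> N2_free_N"
proof (induction \<mu>)
  case (Cons s \<mu>)
  then show ?case
    by (cases \<mu>) (auto simp: proper_Cons deg.pwords_iff deg.Cons_words deg.pos_syl deg.starts_off_def adj_def)
qed (simp add: proper_def)

lemma degree_proper: "\<mu> \<in> proper \<Longrightarrow> hybrid_degree \<mu> = map seg_syl \<mu>"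
proof (induction \<mu>)
  case (Cons s \<mu>)
  have hd: "hybrid_degree (s # \<mu>) = deg.act (seg_syl s) (hybrid_degree \<mu>)"
    using deg.emb_fmult by (simp add: hybrid_degree_def seg_degree_eq)
  have nv: "\<not> seg_is_vertex s" using Cons.prems by (simp add: proper_Cons)
  have "hybrid_degree \<mu> = map seg_syl \<mu>"
    using Cons by (cases "\<mu> = []") (auto simp: proper_Cons hybrid_degree_def)
  moreover have "deg.starts_off (isl (seg_syl s)) (map seg_syl \<mu>)"
    using Cons.prems by (cases \<mu>) (auto simp: proper_Cons deg.starts_off_def adj_def)
  ultimately show ?case using nv by (simp add: hd deg.act_off deg.emb_def)
qed (simp add: proper_def)

lemma degree_in_P: "\<mu> \<in> mor H \<Longrightarrow> hybrid_degree \<mu> \<in> N2_free_N"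
  by (cases rule: mor_cases)
    (auto simp: degree_vpath degree_proper proper_words deg.pwords_iff[of "[]"])

lemma degree_Nil_iff:
  assumes "\<mu> \<in> mor H" shows "hybrid_degree \<mu> = [] \<longleftrightarrow> \<mu> \<notin> proper"
  using assms
proof (cases rule: mor_cases)
  case (vertex x)
  then show ?thesis using proper_not_vertex[of \<mu>] by (auto simp: degree_vpath)
next
  case proper
  then show ?thesis using degree_proper[OF proper] by (auto simp: proper_def)
qed

text \<open>
  For paths that are not vertices this compares the definition of composition with the product
  formula \<open>deg.fmult_pos\<close> for positive words.
\<close>

lemma degree_cmp:
  assumes "\<mu> \<in> mor H" "\<nu> \<in> mor H" "src H \<mu> = rng H \<nu>"
  shows "hybrid_degree (pcmp \<mu> \<nu>) = hybrid_degree \<mu> \<otimes>\<^bsub>Z2_free_Z\<^esub> hybrid_degree \<nu>"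
  using assms(1)
proof (cases rule: mor_cases)
  case (vertex x)
  then show ?thesis by (simp add: degree_vpath)
next
  case p1: proper
  from assms(2) show ?thesis
  proof (cases rule: mor_cases)
    case (vertex x)
    then show ?thesis using p1 degree_in_P[OF assms(1)]
      by (simp add: degree_vpath pcmp_vpath_right deg.fmult_Nil_right deg.pwords_words)
  next
    case p2: proper
    obtain \<mu>' s where \<mu>: "\<mu> = \<mu>' @ [s]" using proper_snocE p1 by blast
    obtain t \<nu>' where \<nu>: "\<nu> = t # \<nu>'" using proper_ConsE p2 by blast
    have c: "composable s t" if "is_DS s = is_DS t"
      using that assms p1 p2 by (auto simp: composable_def \<mu> \<nu> proper_snoc proper_Cons)
    have "hybrid_degree (pcmp \<mu> \<nu>) = map seg_syl (pcmp \<mu> \<nu>)"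
      using degree_proper pcmp_proper_props[OF p1 p2 assms(3)] by blast
    also have "\<dots> = map seg_syl \<mu> \<otimes>\<^bsub>Z2_free_Z\<^esub> map seg_syl \<nu>"
      using deg.fmult_pos[OF proper_words[OF p1] proper_words[OF p2]] p1 p2 c
      by (simp add: \<mu> \<nu> pcmp_proper seg_cmp_props)
    finally show ?thesis by (simp add: degree_proper p1 p2)
  qed
qed

lemma degree_Nil_vertex:
  assumes "\<mu> \<in> mor H" "hybrid_degree \<mu> = []" shows "\<mu> = vpath (rng H \<mu>)"
  using assms(1) by (cases rule: mor_cases) (use assms degree_Nil_iff vpath_ends in auto)

text \<open>
  If neither \<open>p\<close> nor \<open>q\<close> is trivial, their product is a word with either a
  cut between two syllables or a merged syllable, and \<open>\<kappa>\<close> is cut between the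
  corresponding segments or inside the corresponding segment.
\<close>

lemma factorisation_exists:
  assumes "\<kappa> \<in> mor H" "p \<in> N2_free_N" "q \<in> N2_free_N" "hybrid_degree \<kappa> = p \<otimes>\<^bsub>Z2_free_Z\<^esub> q"
  shows "\<exists>\<mu> \<nu>. \<mu> \<in> mor H \<and> \<nu> \<in> mor H \<and> src H \<mu> = rng H \<nu> \<and> \<kappa> = pcmp \<mu> \<nu> \<and>
    hybrid_degree \<mu> = p \<and> hybrid_degree \<nu> = q"
proof -
  interpret small_category H by (rule hybrid_category)
  show ?thesis
  proof (cases "p = [] \<or> q = []")
    case True
    have obj: "rng H \<kappa> \<in> obj H" "src H \<kappa> \<in> obj H" using assms(1) rng_obj src_obj by auto
    from True show ?thesis
    proof
      assume "p = []"
      then show ?thesis using assms obj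
        by (intro exI[of _ "vpath (rng H \<kappa>)"] exI[of _ \<kappa>])
          (auto simp: degree_vpath vpath_mor vpath_ends)
    next
      assume "q = []"
      then show ?thesis using assms obj pcmp_vertex_right[OF assms(1) obj(2)]
        by (intro exI[of _ \<kappa>] exI[of _ "vpath (src H \<kappa>)"])
          (auto simp: degree_vpath vpath_mor vpath_ends deg.fmult_Nil_right deg.pwords_words)
    qed
  next
    case False
    then have ne: "p \<noteq> []" "q \<noteq> []" by auto
    have mult: "p \<otimes>\<^bsub>Z2_free_Z\<^esub> q = (if isl (last p) = isl (hd q)
        then butlast p @ [deg.smul (last p) (hd q)] @ tl q else p @ q)"
      by (rule deg.fmult_pos) (use assms ne in auto)
    have "hybrid_degree \<kappa> \<noteq> []" using mult ne assms by auto
    then have \<kappa>_proper: "\<kappa> \<in> proper" using degree_Nil_iff assms by blast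
    have pos: "deg.pos (last p)" "deg.pos (hd q)" "\<not> deg.triv (last p)" "\<not> deg.triv (hd q)"
      using assms(2,3) ne deg.append_words[of "butlast p" "[last p]"] deg.Cons_words[of "hd q" "tl q"]
        deg.Cons_words[of "last p" "[]"]
      by (auto simp: deg.pwords_iff)
    show ?thesis
    proof (cases "isl (last p) = isl (hd q)")
      case True
      then have "map seg_syl \<kappa> = butlast p @ deg.smul (last p) (hd q) # tl q"
        using mult assms(4) \<kappa>_proper by (simp add: degree_proper)
      then obtain \<mu> s \<nu> where \<kappa>: "\<kappa> = \<mu> @ s # \<nu>" and syl: "map seg_syl \<mu> = butlast p"
          "seg_syl s = deg.smul (last p) (hd q)" "map seg_syl \<nu> = tl q"
        by (auto simp: map_eq_append_conv map_eq_Cons_conv)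
      have "s \<in> Seg" using \<kappa>_proper by (auto simp: \<kappa> proper_def)
      from seg_factor[OF this syl(2) pos(1,2) True] obtain s1 s2 where
        s: "composable s1 s2" "s = scmp s1 s2" "seg_syl s1 = last p" "seg_syl s2 = hd q" .
      have nv: "\<not> seg_is_vertex s1" "\<not> seg_is_vertex s2"
        using s pos triv_seg_syl by metis+
      have s12: "s1 \<in> Seg" "s2 \<in> Seg" "SS s1 = SR s2" "is_DS s1 = is_DS s2"
        using s(1) by (auto simp: composable_def)
      have "\<mu> @ [s] \<in> proper" "s # \<nu> \<in> proper"
        using \<kappa>_proper proper_append[of "\<mu> @ [s]" \<nu>] proper_append[of \<mu> "s # \<nu>"]
        by (cases "\<mu> = []"; cases "\<nu> = []"; auto simp: \<kappa>)+
      then have *: "\<mu> @ [s1] \<in> proper" "s2 # \<nu> \<in> proper"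
        using nv s12 s by (auto simp: proper_snoc proper_Cons adj_scmp_left adj_scmp_right)
      then have "\<kappa> = pcmp (\<mu> @ [s1]) (s2 # \<nu>)"
        using s12 s by (simp add: pcmp_proper \<kappa>)
      moreover have "hybrid_degree (\<mu> @ [s1]) = p" "hybrid_degree (s2 # \<nu>) = q"
        using * syl s ne by (auto simp: degree_proper)
      ultimately show ?thesis using * s12 proper_mor
        by (intro exI[of _ "\<mu> @ [s1]"] exI[of _ "s2 # \<nu>"]) auto
    next
      case False
      then have "map seg_syl \<kappa> = p @ q"
        using mult assms(4) \<kappa>_proper by (simp add: degree_proper)
      then obtain \<mu> \<nu> where \<kappa>: "\<kappa> = \<mu> @ \<nu>" and pq: "map seg_syl \<mu> = p" "map seg_syl \<nu> = q"
        by (auto simp: map_eq_append_conv)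
      then have ne': "\<mu> \<noteq> []" "\<nu> \<noteq> []" using ne by auto
      then have *: "\<mu> \<in> proper" "\<nu> \<in> proper" "adj (last \<mu>) (hd \<nu>)"
        using \<kappa>_proper by (auto simp: \<kappa> proper_append)
      then have "\<kappa> = pcmp \<mu> \<nu>"
        by (auto simp: \<kappa> path_cmp_def adj_def dest!: proper_not_vertex)
      then show ?thesis using * pq proper_mor
        by (intro exI[of _ \<mu>] exI[of _ \<nu>]) (auto simp: degree_proper adj_def)
    qed
  qed
qed

text \<open>
  The degrees determine the numbers and types of the segments of all four paths, so that the two
  compositions follow the same case of the definition and can be compared segment by segment. The
  merged segments are dealt with by \<open>seg_cancel\<close>.
\<close>

lemma factorisation_unique:
  assumes "\<mu> \<in> mor H" "\<nu> \<in> mor H" "src H \<mu> = rng H \<nu>"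
    and "\<mu>' \<in> mor H" "\<nu>' \<in> mor H" "src H \<mu>' = rng H \<nu>'"
    and eq: "pcmp \<mu> \<nu> = pcmp \<mu>' \<nu>'"
    and deg: "hybrid_degree \<mu> = hybrid_degree \<mu>'" "hybrid_degree \<nu> = hybrid_degree \<nu>'"
  shows "\<mu> = \<mu>' \<and> \<nu> = \<nu>'"
proof (cases "hybrid_degree \<mu> = [] \<or> hybrid_degree \<nu> = []")
  case True
  then show ?thesis
  proof
    assume *: "hybrid_degree \<mu> = []"
    have "rng H \<mu> = rng H \<mu>'" using pcmp_props(2) assms by metis
    then have "\<mu> = vpath (rng H \<mu>)" "\<mu>' = vpath (rng H \<mu>)"
      using degree_Nil_vertex[of \<mu>] degree_Nil_vertex[of \<mu>'] assms * by auto
    then show ?thesis using eq by (metis pcmp_vpath_left)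
  next
    assume *: "hybrid_degree \<nu> = []"
    have "\<nu> = vpath (rng H \<nu>)" "\<nu>' = vpath (rng H \<nu>')"
      using degree_Nil_vertex[of \<nu>] degree_Nil_vertex[of \<nu>'] assms * by auto
    moreover have "rng H \<nu> \<in> obj H" "rng H \<nu>' \<in> obj H"
      using small_category.rng_obj[OF hybrid_category] assms by auto
    ultimately have "pcmp \<mu> \<nu> = \<mu>" "pcmp \<mu>' \<nu>' = \<mu>'" "src H \<nu> = rng H \<nu>" "src H \<nu>' = rng H \<nu>'"
      using pcmp_vertex_right assms vpath_ends(2) by (metis hybrid_simps(3))+
    then show ?thesis using eq \<open>\<nu> = _\<close> \<open>\<nu>' = _\<close> assms by metis
  qed
next
  case False
  then have P: "\<mu> \<in> proper" "\<nu> \<in> proper" "\<mu>' \<in> proper" "\<nu>' \<in> proper"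
    using assms degree_Nil_iff by metis+
  then have syl: "map seg_syl \<mu> = map seg_syl \<mu>'" "map seg_syl \<nu> = map seg_syl \<nu>'"
    using deg by (simp_all add: degree_proper)
  obtain \<mu>1 s where \<mu>: "\<mu> = \<mu>1 @ [s]" using proper_snocE P by blast
  obtain \<mu>1' s' where \<mu>': "\<mu>' = \<mu>1' @ [s']" using proper_snocE P by blast
  obtain t \<nu>1 where \<nu>: "\<nu> = t # \<nu>1" using proper_ConsE P by blast
  obtain t' \<nu>1' where \<nu>': "\<nu>' = t' # \<nu>1'" using proper_ConsE P by blast
  have syl': "seg_syl s = seg_syl s'" "seg_syl t = seg_syl t'" "length \<mu>1 = length \<mu>1'"
    using syl map_eq_imp_length_eq[of seg_syl \<mu>1 seg_syl \<mu>1'] by (auto simp: \<mu> \<mu>' \<nu> \<nu>')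
  then have DS: "is_DS s = is_DS s'" "is_DS t = is_DS t'" using isl_seg_syl by metis+
  have Seg: "s \<in> Seg" "s' \<in> Seg" "t \<in> Seg" "t' \<in> Seg"
    using P by (auto simp: \<mu> \<mu>' \<nu> \<nu>' proper_snoc proper_Cons)
  show ?thesis
  proof (cases "is_DS s = is_DS t")
    case True
    then have "\<mu>1 = \<mu>1'" "scmp s t = scmp s' t'" "\<nu>1 = \<nu>1'"
      using eq DS P syl' by (auto simp: \<mu> \<mu>' \<nu> \<nu>' pcmp_proper)
    moreover have "composable s t" "composable s' t'"
      using True DS Seg assms by (auto simp: composable_def \<mu> \<mu>' \<nu> \<nu>')
    ultimately show ?thesis using seg_cancel syl' by (auto simp: \<mu> \<mu>' \<nu> \<nu>')
  next
    case False
    then show ?thesis using eq DS P syl' by (auto simp: \<mu> \<mu>' \<nu> \<nu>' pcmp_proper)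
  qed
qed

theorem hybrid_P_graph: "P_graph Z2_free_Z N2_free_N H hybrid_degree"
proof (intro P_graph.intro P_graph_axioms.intro)
  show "quasi_lattice_ordered Z2_free_Z N2_free_N" by (rule deg.free_product_ql)
  show "small_category H" by (rule hybrid_category)
  show "countable (mor H)" by (rule countable_hybrid)
  show "hybrid_degree \<mu> \<in> N2_free_N" if "\<mu> \<in> mor H" for \<mu> by (rule degree_in_P[OF that])
  show "hybrid_degree (idn H x) = \<one>\<^bsub>Z2_free_Z\<^esub>" if "x \<in> obj H" for x
    by (simp add: degree_vpath)
  show "hybrid_degree (cmp H \<mu> \<nu>) = hybrid_degree \<mu> \<otimes>\<^bsub>Z2_free_Z\<^esub> hybrid_degree \<nu>"
    if "\<mu> \<in> mor H" "\<nu> \<in> mor H" "src H \<mu> = rng H \<nu>" for \<mu> \<nu>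
    using degree_cmp[OF that] by simp
  fix \<kappa> p q
  assume *: "\<kappa> \<in> mor H" "p \<in> N2_free_N" "q \<in> N2_free_N" "hybrid_degree \<kappa> = p \<otimes>\<^bsub>Z2_free_Z\<^esub> q"
  from factorisation_exists[OF this] obtain \<mu> \<nu> where \<mu>\<nu>: "\<mu> \<in> mor H" "\<nu> \<in> mor H"
    "src H \<mu> = rng H \<nu>" "\<kappa> = pcmp \<mu> \<nu>" "hybrid_degree \<mu> = p" "hybrid_degree \<nu> = q" by blast
  show "\<exists>!(\<mu>, \<nu>). \<mu> \<in> mor H \<and> \<nu> \<in> mor H \<and> src H \<mu> = rng H \<nu> \<and> \<kappa> = cmp H \<mu> \<nu> \<and>
      hybrid_degree \<mu> = p \<and> hybrid_degree \<nu> = q"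
  proof (rule ex1I[of _ "(\<mu>, \<nu>)"])
    fix z assume z: "case z of (\<mu>, \<nu>) \<Rightarrow> \<mu> \<in> mor H \<and> \<nu> \<in> mor H \<and> src H \<mu> = rng H \<nu> \<and>
      \<kappa> = cmp H \<mu> \<nu> \<and> hybrid_degree \<mu> = p \<and> hybrid_degree \<nu> = q"
    obtain \<mu>' \<nu>' where "z = (\<mu>', \<nu>')" by (cases z)
    then show "z = (\<mu>, \<nu>)"
      using factorisation_unique[of \<mu>' \<nu>' \<mu> \<nu>] z \<mu>\<nu> by simp
  qed (use \<mu>\<nu> in simp)
qed

end

section \<open>Extensions of finite paths\<close>

definition path_le :: "('v, 'e) path \<Rightarrow> ('v, 'e) path \<Rightarrow> bool" where
  "path_le p p' \<longleftrightarrow> fst p' = fst p \<and> (\<exists>x. snd p' = snd p @ x)"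

lemma path_le_length: "path_le p r \<Longrightarrow> path_length r \<le> path_length p \<Longrightarrow> r = p"
  by (auto simp: path_le_def path_length_def prod_eq_iff)

text \<open>
  A path that starts with \<open>p\<close> and is no longer than \<open>p\<close> is
  \<open>p\<close> itself, and likewise for \<open>q\<close>.
\<close>

lemma path_le_two:
  assumes "path_le p r" "path_le q r" "path_length r \<le> max (path_length p) (path_length q)"
  shows "r \<in> {p, q}"
  using assms path_le_length unfolding le_max_iff_disj by blast

context hybrid_graph
begin

sublocale PG: P_graph Z2_free_Z N2_free_N H hybrid_degree
  by (rule hybrid_P_graph)

abbreviation "mce \<equiv> MCE Z2_free_Z N2_free_N H hybrid_degree"

definition extends :: "('v, 'e, 'w, 'f) hpath \<Rightarrow> ('v, 'e, 'w, 'f) hpath \<Rightarrow> bool" where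
  "extends \<mu> \<kappa> \<longleftrightarrow> (\<exists>\<alpha> \<in> mor H. src H \<mu> = rng H \<alpha> \<and> \<kappa> = pcmp \<mu> \<alpha>)"

lemma mce_extends:
  "\<kappa> \<in> mce \<mu> \<nu> \<Longrightarrow> \<kappa> \<in> mor H \<and> extends \<mu> \<kappa> \<and> extends \<nu> \<kappa>"
  unfolding MCE_def extends_def hybrid_simps(5) by blast

lemma extends_rng: "\<mu> \<in> mor H \<Longrightarrow> extends \<mu> \<kappa> \<Longrightarrow> rng H \<kappa> = rng H \<mu>"
  unfolding extends_def using pcmp_props(2) by blast

lemma mce_extension: "\<mu> \<in> mor H \<Longrightarrow> extends \<mu> \<nu> \<Longrightarrow> mce \<mu> \<nu> = {\<nu>}"
  unfolding extends_def using PG.MCE_extension by auto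

lemma pcmp_last: "\<mu> \<in> proper \<Longrightarrow> pcmp \<mu> \<alpha> = butlast \<mu> @ pcmp [last \<mu>] \<alpha>"
proof -
  assume \<mu>: "\<mu> \<in> proper"
  then obtain \<mu>' s where s: "\<mu> = \<mu>' @ [s]" by (rule proper_snocE)
  then have "\<not> is_vertex_path [s]" using \<mu> by (simp add: is_vertex_path_def proper_snoc)
  then show ?thesis using proper_not_vertex[OF \<mu>] by (simp add: path_cmp_def s)
qed

lemma nth_proper:
  assumes "\<mu> \<in> proper" "i < length \<mu>" shows "[\<mu> ! i] \<in> proper"
proof -
  have "\<mu> ! i \<in> set \<mu>" using assms(2) by simp
  then show ?thesis using assms(1) unfolding proper_def by auto
qed

lemma long_proper: "\<mu> \<in> mor H \<Longrightarrow> length \<mu> > 1 \<Longrightarrow> \<mu> \<in> proper"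
  by (cases rule: mor_cases) auto

lemma nth_mor: "\<mu> \<in> mor H \<Longrightarrow> i < length \<mu> \<Longrightarrow> [\<mu> ! i] \<in> mor H"
proof (cases rule: mor_cases, assumption)
  fix x assume "x \<in> obj H" "\<mu> = vpath x" "\<mu> \<in> mor H" "i < length \<mu>"
  then show ?thesis by (elim vpath_object) simp
qed (use nth_proper proper_mor in auto)

lemma mor_not_Nil: "\<mu> \<in> mor H \<Longrightarrow> \<mu> \<noteq> []"
  by (simp add: finite_paths_def)

text \<open>
  Composition with a further path leaves the first segment as it is or prolongs it. In both cases
  the new first segment is a composite of \<open>s\<close> with a path \<open>\<alpha>'\<close>,
  which is \<open>\<alpha>\<close> itself, the first segment of \<open>\<alpha>\<close>, or a
  vertex.
\<close>

lemma segment_extension: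
  assumes s: "[s] \<in> proper" and \<alpha>: "\<alpha> \<in> mor H" "SS s = rng H \<alpha>"
  shows "\<exists>r \<rho>. pcmp [s] \<alpha> = r # \<rho> \<and> (r = s \<or> (\<exists>t. composable s t \<and> r = scmp s t)) \<and>
    (\<exists>\<alpha>' \<in> mor H. SS s = rng H \<alpha>' \<and> [r] = pcmp [s] \<alpha>')"
  using \<alpha>(1)
proof (cases rule: mor_cases)
  case (vertex x)
  then show ?thesis using s \<alpha> by (auto simp: pcmp_vpath_right intro!: bexI[of _ \<alpha>])
next
  case proper
  then obtain t \<beta> where t: "\<alpha> = t # \<beta>" by (rule proper_ConsE)
  have sg: "s \<in> Seg" "t \<in> Seg" "SS s = SR t" "[t] \<in> proper"
    using s proper \<alpha> by (auto simp: t proper_Cons)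
  show ?thesis
  proof (cases "is_DS s = is_DS t")
    case True
    then have "composable s t" using sg by (simp add: composable_def)
    then show ?thesis
      using True sg proper pcmp_proper[of "[]" s t \<beta>] pcmp_proper[of "[]" s t "[]"] s proper_mor
      by (auto simp: t intro!: bexI[of _ "[t]"])
  next
    case False
    have "SS s \<in> obj H" using seg_ends_obj sg by blast
    then show ?thesis
      using False sg proper pcmp_proper[of "[]" s t \<beta>] s vpath_mor vpath_ends(1)
      by (auto simp: t pcmp_vpath_right intro!: bexI[of _ "vpath (SS s)"])
  qed
qed

text \<open>
  Composition does not touch the segments of \<open>\<mu>\<close> before the last one, and
  \<open>segment_extension\<close> describes its effect on the last one. A vertex
  \<open>\<mu>\<close> fits the pattern as well: it has no segment before its only one, and
  composition with it is the identity, so that \<open>\<alpha>\<close> can be chosen as the first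
  segment of \<open>\<kappa>\<close>.
\<close>

lemma extends_prefix:
  assumes \<mu>: "\<mu> \<in> mor H" and "extends \<mu> \<kappa>" and m: "m = length \<mu>"
  shows "\<forall>i < m - 1. \<kappa> ! i = \<mu> ! i"
    and "\<exists>\<alpha> \<in> mor H. src H [\<mu> ! (m - 1)] = rng H \<alpha> \<and> [\<kappa> ! (m - 1)] = cmp H [\<mu> ! (m - 1)] \<alpha>"
proof -
  obtain \<alpha> where \<alpha>: "\<alpha> \<in> mor H" "src H \<mu> = rng H \<alpha>" "\<kappa> = pcmp \<mu> \<alpha>"
    using assms(2) by (auto simp: extends_def)
  have "(\<forall>i < m - 1. \<kappa> ! i = \<mu> ! i) \<and>
    (\<exists>\<alpha> \<in> mor H. src H [\<mu> ! (m - 1)] = rng H \<alpha> \<and> [\<kappa> ! (m - 1)] = cmp H [\<mu> ! (m - 1)] \<alpha>)"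
    using \<mu>
  proof (cases rule: mor_cases)
    case (vertex x)
    then obtain s where s: "\<mu> = [s]" using vpath_object by metis
    have "\<alpha> \<noteq> []" using \<alpha>(1) by (rule mor_not_Nil)
    then have "[\<alpha> ! 0] \<in> mor H" "rng H [\<alpha> ! 0] = rng H \<alpha>"
      using nth_mor[OF \<alpha>(1), of 0] by (auto simp: hd_conv_nth)
    moreover have "pcmp [s] \<beta> = \<beta>" for \<beta>
      using pcmp_vpath_left[of x \<beta>] vertex(2) s by simp
    ultimately show ?thesis using \<alpha> m unfolding s
      by (auto intro!: bexI[of _ "[\<alpha> ! 0]"])
  next
    case proper
    then obtain \<mu>' s where s: "\<mu> = \<mu>' @ [s]" by (rule proper_snocE)
    then have sp: "[s] \<in> proper" using proper by (simp add: proper_snoc proper_Cons)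
    have "SS s = rng H \<alpha>" using \<alpha> s by simp
    from segment_extension[OF sp \<alpha>(1) this] obtain r \<rho> \<alpha>' where
      r: "pcmp [s] \<alpha> = r # \<rho>" "\<alpha>' \<in> mor H" "SS s = rng H \<alpha>'" "[r] = pcmp [s] \<alpha>'" by blast
    have "\<kappa> = \<mu>' @ r # \<rho>" using \<alpha>(3) pcmp_last[OF proper] s r by simp
    then show ?thesis using r m s by (auto simp: nth_append)
  qed
  then show "\<forall>i < m - 1. \<kappa> ! i = \<mu> ! i"
    and "\<exists>\<alpha> \<in> mor H. src H [\<mu> ! (m - 1)] = rng H \<alpha> \<and> [\<kappa> ! (m - 1)] = cmp H [\<mu> ! (m - 1)] \<alpha>"
    by blast+
qed

lemma pcmp_append:
  assumes "\<mu> @ \<nu> \<in> proper" "\<mu> \<noteq> []" "\<nu> \<noteq> []"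
  shows "\<mu> \<in> proper" "\<nu> \<in> proper" "src H \<mu> = rng H \<nu>" "pcmp \<mu> \<nu> = \<mu> @ \<nu>"
  using assms by (auto simp: proper_append adj_def path_cmp_def dest!: proper_not_vertex)

text \<open>
  If \<open>\<nu>\<close> has more segments than \<open>\<mu>\<close>, its first \<open>m\<close>
  segments form the composite of \<open>\<mu>\<close> with \<open>\<alpha>\<close>, and the
  remaining ones are composed with it without merging, because neighbouring segments of
  \<open>\<nu>\<close> have different types.
\<close>

lemma extendsI:
  assumes \<mu>: "\<mu> \<in> mor H" and \<nu>: "\<nu> \<in> mor H" and m: "m = length \<mu>" "m < length \<nu>"
    and prefix: "\<forall>i < m - 1. \<mu> ! i = \<nu> ! i"
    and \<alpha>: "\<alpha> \<in> mor H" "src H [\<mu> ! (m - 1)] = rng H \<alpha>" "[\<nu> ! (m - 1)] = cmp H [\<mu> ! (m - 1)] \<alpha>"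
  shows "extends \<mu> \<nu>"
  using \<mu>
proof (cases rule: mor_cases)
  case (vertex x)
  then obtain s where s: "\<mu> = [s]" using vpath_object by metis
  have "\<alpha> = [\<nu> ! 0]" using \<alpha>(3) vertex s m(1) pcmp_vpath_left by (metis One_nat_def diff_self_eq_0
      hybrid_simps(5) length_Cons list.size(3) nth_Cons_0)
  then have "src H \<mu> = rng H \<nu>"
    using \<alpha>(2) s m mor_not_Nil[OF \<nu>] by (simp add: hd_conv_nth)
  then show ?thesis using vertex \<nu> by (auto simp: extends_def)
next
  case proper
  then obtain \<mu>' s where s: "\<mu> = \<mu>' @ [s]" by (rule proper_snocE)
  have "\<nu> \<in> proper" using \<nu> m s by (cases rule: mor_cases) auto
  have m': "length \<mu>' = m - 1" "\<mu> ! (m - 1) = s" using m s by auto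
  have "take (m - 1) \<nu> = \<mu>'"
    using m prefix s by (intro nth_equalityI) (auto simp: nth_append)
  then have "\<nu> = (\<mu>' @ [\<nu> ! (m - 1)]) @ drop m \<nu>"
    using m s id_take_nth_drop[of "m - 1" \<nu>] by simp
  moreover have "[\<nu> ! (m - 1)] = pcmp [s] \<alpha>" using \<alpha>(3) m' by simp
  then have "\<mu>' @ [\<nu> ! (m - 1)] = pcmp \<mu> \<alpha>"
    using pcmp_last[OF proper, of \<alpha>] s by simp
  ultimately have eq: "\<nu> = pcmp \<mu> \<alpha> @ drop m \<nu>" by metis
  have src: "src H \<mu> = rng H \<alpha>" using \<alpha>(2) m' s by simp
  have "pcmp \<mu> \<alpha> \<noteq> []" using mor_not_Nil pcmp_props(1)[OF \<mu> \<alpha>(1) src] by blast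
  note split = pcmp_append[OF _ this, of "drop m \<nu>", folded eq]
  have ne: "drop m \<nu> \<noteq> []" using m by simp
  have \<rho>: "drop m \<nu> \<in> mor H" "src H \<alpha> = rng H (drop m \<nu>)"
    using split(2,3)[OF \<open>\<nu> \<in> proper\<close> ne] proper_mor pcmp_props(3)[OF \<mu> \<alpha>(1) src] by auto
  have "\<nu> = pcmp (pcmp \<mu> \<alpha>) (drop m \<nu>)"
    using split(4)[OF \<open>\<nu> \<in> proper\<close> ne] eq by simp
  also have "\<dots> = pcmp \<mu> (pcmp \<alpha> (drop m \<nu>))"
    using PG.cmp_assoc[OF \<mu> \<alpha>(1) \<rho>(1) src \<rho>(2)] by simp
  finally show ?thesis
    using pcmp_props[OF \<alpha>(1) \<rho>] src unfolding extends_def by metis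
qed

section \<open>Minimal common extensions of finite paths\<close>

text \<open>
  A common extension has the same first \<open>m\<close> segments as \<open>\<nu>\<close>, because
  \<open>\<nu>\<close> has more than \<open>m\<close> of them. Hence what
  \<open>extends_prefix\<close> says about extensions of \<open>\<mu>\<close> holds for
  \<open>\<nu>\<close> itself.
\<close>

lemma mce_longer:
  assumes "\<mu> \<in> mor H" "\<nu> \<in> mor H" "m = length \<mu>" "m < length \<nu>"
  shows "mce \<mu> \<nu> = (if (\<forall>i < m - 1. \<mu> ! i = \<nu> ! i) \<and>
      (\<exists>\<alpha> \<in> mor H. src H [\<mu> ! (m - 1)] = rng H \<alpha> \<and> [\<nu> ! (m - 1)] = cmp H [\<mu> ! (m - 1)] \<alpha>)
    then {\<nu>} else {})" (is "_ = (if ?C then _ else _)")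
proof (cases ?C)
  case True
  then show ?thesis using mce_extension[OF assms(1)] extendsI[OF assms] by auto
next
  case False
  have False if "\<kappa> \<in> mce \<mu> \<nu>" for \<kappa>
  proof -
    note ext = mce_extends[OF that]
    have "m - 1 < length \<nu> - 1" using assms(3,4) mor_not_Nil[OF assms(1)] by (cases \<mu>) auto
    then have "\<kappa> ! i = \<nu> ! i" if "i \<le> m - 1" for i
      using extends_prefix(1)[OF assms(2) _ refl, of \<kappa>] ext that by simp
    moreover have "\<forall>i < m - 1. \<kappa> ! i = \<mu> ! i"
      and "\<exists>\<alpha> \<in> mor H. src H [\<mu> ! (m - 1)] = rng H \<alpha> \<and> [\<kappa> ! (m - 1)] = cmp H [\<mu> ! (m - 1)] \<alpha>"
      using extends_prefix[OF assms(1) _ assms(3), of \<kappa>] ext by blast+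
    ultimately show False using False by auto
  qed
  then show ?thesis using False by auto
qed

text \<open>
  If the paths agree before their last segments, their common part is split off by
  \<open>MCE_left_mult\<close>; for \<open>m = 1\<close> that part is a vertex.
\<close>

lemma mce_same_length:
  assumes "\<mu> \<in> mor H" "\<nu> \<in> mor H" "m = length \<mu>" "m = length \<nu>"
  shows "mce \<mu> \<nu> = (if \<forall>i < m - 1. \<mu> ! i = \<nu> ! i
    then left_mult H (init_path E F v w \<mu>) (mce [\<mu> ! (m - 1)] [\<nu> ! (m - 1)]) else {})"
    (is "_ = (if ?C then _ else _)")
proof (cases "m = 1")
  case True
  then obtain s t where st: "\<mu> = [s]" "\<nu> = [t]"
    using assms(3,4) by (auto simp: length_Suc_conv)
  have obj: "rng H \<mu> \<in> obj H" using PG.rng_obj assms(1) by blast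
  have "rng H \<kappa> = rng H \<mu>" if "\<kappa> \<in> mce \<mu> \<nu>" for \<kappa>
    using that mce_extends extends_rng assms(1) by blast
  then have "left_mult H (vpath (rng H \<mu>)) (mce \<mu> \<nu>) = mce \<mu> \<nu>"
    using vpath_ends(2)[OF obj] unfolding left_mult_def hybrid_simps(3,5) pcmp_vpath_left by auto
  moreover have "init_path E F v w \<mu> = vpath (rng H \<mu>)" by (simp add: init_path_def st)
  ultimately show ?thesis using True by (simp add: st)
next
  case False
  then have m: "m > 1" using assms(3) mor_not_Nil[OF assms(1)] by (cases m) auto
  have P: "\<mu> \<in> proper" "\<nu> \<in> proper"
    using assms m long_proper by auto
  obtain \<mu>' s where s: "\<mu> = \<mu>' @ [s]" using P(1) by (rule proper_snocE)
  obtain \<nu>' t where t: "\<nu> = \<nu>' @ [t]" using P(2) by (rule proper_snocE)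
  have len: "length \<mu>' = m - 1" "length \<nu>' = m - 1" using assms s t by auto
  then have ne: "\<mu>' \<noteq> []" "\<nu>' \<noteq> []" using m by auto
  show ?thesis
  proof (cases ?C)
    case True
    then have "\<mu>' = \<nu>'" using len s t by (intro nth_equalityI) (auto simp: nth_append)
    note cs = pcmp_append[OF P(1)[unfolded s] ne(1)] and ct = pcmp_append[OF P(2)[unfolded t] ne(2), folded \<open>\<mu>' = \<nu>'\<close>]
    have "mce (cmp H \<mu>' [s]) (cmp H \<mu>' [t]) = left_mult H \<mu>' (mce [s] [t])"
      using cs ct proper_mor by (intro PG.MCE_left_mult) auto
    moreover have "cmp H \<mu>' [s] = \<mu>" "cmp H \<mu>' [t] = \<nu>" using cs(4) ct(4) s t \<open>\<mu>' = \<nu>'\<close> by auto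
    moreover have "init_path E F v w \<mu> = \<mu>'" using ne by (simp add: init_path_def s)
    moreover have "\<mu> ! (m - 1) = s" "\<nu> ! (m - 1) = t" using len s t by (metis nth_append_length)+
    ultimately show ?thesis using True by auto
  next
    case F: False
    have False if "\<kappa> \<in> mce \<mu> \<nu>" for \<kappa>
      using mce_extends[OF that] extends_prefix(1)[OF assms(1), of \<kappa> m]
        extends_prefix(1)[OF assms(2), of \<kappa> m] assms(3,4) F by metis
    then show ?thesis using F by auto
  qed
qed

lemma mce_vertex: "x \<in> obj H \<Longrightarrow> \<nu> \<in> mor H \<Longrightarrow> mce (vpath x) \<nu> \<subseteq> {\<nu>}"
proof (cases "rng H \<nu> = x")
  case True
  assume "x \<in> obj H" "\<nu> \<in> mor H"
  then have "extends (vpath x) \<nu>" using True vpath_ends(2) by (auto simp: extends_def)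
  then show ?thesis using mce_extension vpath_mor \<open>x \<in> obj H\<close> by simp
next
  case False
  assume "x \<in> obj H" "\<nu> \<in> mor H"
  show ?thesis
  proof (rule subsetI)
    fix \<kappa> assume "\<kappa> \<in> mce (vpath x) \<nu>"
    then have "extends (vpath x) \<kappa>" "extends \<nu> \<kappa>" using mce_extends by blast+
    then have "rng H \<kappa> = rng H (vpath x)" "rng H \<kappa> = rng H \<nu>"
      using extends_rng[of "vpath x" \<kappa>] extends_rng[OF \<open>\<nu> \<in> mor H\<close>, of \<kappa>]
        vpath_mor[OF \<open>x \<in> obj H\<close>] by simp_all
    then show "\<kappa> \<in> {\<nu>}" using False vpath_ends(1)[OF \<open>x \<in> obj H\<close>] by simp
  qed
qed

text \<open>
  The join of two positive syllables of the same type.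
\<close>

fun syl_max :: "int \<times> int + int \<Rightarrow> int \<times> int + int \<Rightarrow> int \<times> int + int" where
  "syl_max (Inl (a, b)) (Inl (c, d)) = Inl (max a c, max b d)"
| "syl_max (Inr a) (Inr c) = Inr (max a c)"
| "syl_max x y = x"

text \<open>
  The degree of a minimal common extension is the least upper bound of the two degrees, hence at
  most the syllable of the maxima. So it is a single syllable, and the extension is a single
  segment.
\<close>

lemma mce_segments_degree:
  assumes "[s] \<in> proper" "[t] \<in> proper" "is_DS s = is_DS t" "\<kappa> \<in> mce [s] [t]"
  shows "\<exists>r. \<kappa> = [r] \<and> is_DS r = is_DS s \<and>
    deg.pos (deg.smul (deg.sinv (seg_syl r)) (syl_max (seg_syl s) (seg_syl t)))"
proof -
  let ?c = "syl_max (seg_syl s) (seg_syl t)"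
  have c: "isl ?c \<longleftrightarrow> \<not> is_DS s" "deg.pos ?c" "deg.pos (deg.smul (deg.sinv (seg_syl s)) ?c)"
    "deg.pos (deg.smul (deg.sinv (seg_syl t)) ?c)"
    using assms(3) by (cases s rule: seg_syl.cases; cases t rule: seg_syl.cases; auto)+
  have st: "hybrid_degree [s] = deg.emb (seg_syl s)" "hybrid_degree [t] = deg.emb (seg_syl t)"
    using assms(1,2) by (auto simp: degree_proper deg.emb_def proper_Cons)
  have mor: "[s] \<in> mor H" "[t] \<in> mor H" using assms(1,2) proper_mor by auto
  have "deg.emb ?c \<in> ql_ubs Z2_free_Z N2_free_N (hybrid_degree [s]) (hybrid_degree [t])"
    using c assms(3) by (simp add: ql_ubs_def st deg.ql_le_emb deg.pos_syl deg.emb_pwords)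
  then have "ql_le Z2_free_Z N2_free_N (ql_join Z2_free_Z N2_free_N (hybrid_degree [s]) (hybrid_degree [t])) (deg.emb ?c)"
    using PG.ql_is_join_ql_join[OF PG.d_in_P[OF mor(1)] PG.d_in_P[OF mor(2)]]
    unfolding ql_is_join_def by blast
  then have le: "ql_le Z2_free_Z N2_free_N (hybrid_degree \<kappa>) (deg.emb ?c)"
    using assms(4) unfolding MCE_def by simp
  obtain \<alpha> where \<alpha>: "\<alpha> \<in> mor H" "SS s = rng H \<alpha>" "\<kappa> = pcmp [s] \<alpha>"
    using mce_extends[OF assms(4)] unfolding extends_def by auto
  have "\<kappa> \<in> proper"
    using \<alpha>(1)
  proof (cases rule: mor_cases)
    case (vertex x)
    then show ?thesis using \<alpha>(3) assms(1) by (simp add: pcmp_vpath_right)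
  next
    case proper
    then show ?thesis using \<alpha> pcmp_proper_props(1)[OF assms(1)] by simp
  qed
  then have "hybrid_degree \<kappa> \<in> N2_free_N" "hybrid_degree \<kappa> = map seg_syl \<kappa>" "\<kappa> \<noteq> []"
    by (auto simp: degree_proper proper_words) (simp add: proper_def)
  then obtain k where "map seg_syl \<kappa> = [k]" "isl k = isl ?c" "deg.pos (deg.smul (deg.sinv k) ?c)"
    using deg.below_emb[of "map seg_syl \<kappa>" ?c] le c(2) deg.pos_syl by auto
  then show ?thesis using c(1) by (auto simp: map_eq_Cons_conv)
qed

lemma segment_extends:
  assumes "[s] \<in> proper" "extends [s] (r # \<rho>)"
  shows "is_DS r = is_DS s"
    and "s = DS p \<Longrightarrow> \<exists>p'. r = DS p' \<and> path_le p p'"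
    and "s = CS i (a, b) \<Longrightarrow> \<exists>a' b'. r = CS i (a', b') \<and> path_le a a' \<and> path_le b b'"
proof -
  obtain \<alpha> where \<alpha>: "\<alpha> \<in> mor H" "SS s = rng H \<alpha>" "r # \<rho> = pcmp [s] \<alpha>"
    using assms(2) unfolding extends_def by auto
  then consider "r = s" | t where "composable s t" "r = scmp s t"
    using segment_extension[OF assms(1) \<alpha>(1,2)] by auto
  then have "is_DS r = is_DS s \<and> (s = DS p \<longrightarrow> (\<exists>p'. r = DS p' \<and> path_le p p')) \<and>
      (s = CS i (a, b) \<longrightarrow> (\<exists>a' b'. r = CS i (a', b') \<and> path_le a a' \<and> path_le b b'))"
  proof cases
    case 1
    then show ?thesis by (auto simp: path_le_def)
  next
    case 2
    from 2(1) show ?thesis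
      by (cases rule: composable_cases) (use 2 in \<open>auto simp: path_le_def path_cat_src_cmp\<close>)
  qed
  then show "is_DS r = is_DS s"
    and "s = DS p \<Longrightarrow> \<exists>p'. r = DS p' \<and> path_le p p'"
    and "s = CS i (a, b) \<Longrightarrow> \<exists>a' b'. r = CS i (a', b') \<and> path_le a a' \<and> path_le b b'"
    by blast+
qed

text \<open>
  For nontrivial segments of the same type, in each coordinate the extension starts with both given
  paths and is no longer than the longer one, so it is one of the two.
\<close>

lemma finite_mce_segments:
  assumes "[s] \<in> mor H" "[t] \<in> mor H"
  shows "finite (mce [s] [t])"
proof (cases "[s] \<in> proper \<and> [t] \<in> proper")
  case False
  then consider x where "x \<in> obj H" "[s] = vpath x" | x where "x \<in> obj H" "[t] = vpath x"
    using assms mor_iff by blast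
  then show ?thesis
  proof cases
    case 1
    then show ?thesis using mce_vertex[OF 1(1) assms(2)] finite_subset by auto
  next
    case 2
    then show ?thesis using mce_vertex[OF 2(1) assms(1)] finite_subset
      by (subst MCE_commute) auto
  qed
next
  case True
  then have P: "[s] \<in> proper" "[t] \<in> proper" by auto
  have types: "is_DS s = is_DS t" if \<kappa>: "\<kappa> \<in> mce [s] [t]" for \<kappa>
  proof -
    obtain r \<rho> where "\<kappa> = r # \<rho>" using mce_extends[OF \<kappa>] mor_not_Nil by (cases \<kappa>) auto
    then show ?thesis using segment_extends(1)[OF P(1)] segment_extends(1)[OF P(2)] mce_extends[OF \<kappa>] by blast
  qed
  show ?thesis
  proof (cases "is_DS s = is_DS t")
    case False
    then have "mce [s] [t] = {}" using types by blast
    then show ?thesis by simp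
  next
    case DS: True
    have Seg: "s \<in> Seg" "t \<in> Seg" using P by (auto simp: proper_Cons)
    have ext: "extends [s] \<kappa>" "extends [t] \<kappa>" if "\<kappa> \<in> mce [s] [t]" for \<kappa>
      using mce_extends[OF that] by auto
    note deg = mce_segments_degree[OF P DS]
    from Seg(1) show ?thesis
    proof (cases rule: seg_cases)
      case (D p)
      then obtain q where t: "t = DS q" using DS by (auto simp: is_DS_iff)
      have "mce [s] [t] \<subseteq> (\<lambda>p. [DS p]) ` {p, q}"
      proof
        fix \<kappa> assume \<kappa>: "\<kappa> \<in> mce [s] [t]"
        from deg[OF this] obtain r where r: "\<kappa> = [r]"
          "deg.pos (deg.smul (deg.sinv (seg_syl r)) (syl_max (seg_syl s) (seg_syl t)))" by blast
        obtain p' where p': "r = DS p'" "path_le p p'" "path_le q p'"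
          using segment_extends(2)[OF P(1), of r "[]" p] segment_extends(2)[OF P(2), of r "[]" q]
            ext[OF \<kappa>] D t r(1) by auto
        then have "path_length p' \<le> max (path_length p) (path_length q)"
          using r(2) D t by auto
        then have "p' \<in> {p, q}" using path_le_two p' by blast
        then show "\<kappa> \<in> (\<lambda>p. [DS p]) ` {p, q}" using p'(1) r(1) by auto
      qed
      then show ?thesis by (rule finite_subset) simp
    next
      case (C i a b)
      then obtain j c d where t: "t = CS j (c, d)" using DS by (cases t rule: seg_syl.cases) auto
      have "mce [s] [t] \<subseteq> (\<lambda>z. [CS i z]) ` ({a, c} \<times> {b, d})"
      proof
        fix \<kappa> assume \<kappa>: "\<kappa> \<in> mce [s] [t]"
        from deg[OF this] obtain r where r: "\<kappa> = [r]"
          "deg.pos (deg.smul (deg.sinv (seg_syl r)) (syl_max (seg_syl s) (seg_syl t)))" by blast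
        obtain a' b' where ab: "r = CS i (a', b')" "path_le a a'" "path_le b b'" "path_le c a'" "path_le d b'"
          using segment_extends(3)[OF P(1), of r "[]" i a b] segment_extends(3)[OF P(2), of r "[]" j c d]
            ext[OF \<kappa>] C t r(1) by auto
        then have "path_length a' \<le> max (path_length a) (path_length c)"
          "path_length b' \<le> max (path_length b) (path_length d)"
          using r(2) C t by auto
        then have "a' \<in> {a, c}" "b' \<in> {b, d}" using path_le_two ab by blast+
        then show "\<kappa> \<in> (\<lambda>z. [CS i z]) ` ({a, c} \<times> {b, d})" using ab r(1) by auto
      qed
      then show ?thesis by (rule finite_subset) simp
    qed
  qed
qed

lemma finite_mce:
  assumes "\<mu> \<in> mor H" "\<nu> \<in> mor H" "length \<mu> \<le> length \<nu>"
  shows "finite (mce \<mu> \<nu>)"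
proof (cases "length \<mu> = length \<nu>")
  case True
  have fin: "finite (left_mult H \<kappa> X)" if "finite X" for \<kappa> X
    by (rule finite_subset[of _ "cmp H \<kappa> ` X"]) (use that in \<open>auto simp: left_mult_def\<close>)
  let ?m = "length \<mu>"
  have "?m - 1 < length \<mu>" "?m - 1 < length \<nu>"
    using mor_not_Nil[OF assms(1)] mor_not_Nil[OF assms(2)] True by auto
  then have "finite (mce [\<mu> ! (?m - 1)] [\<nu> ! (?m - 1)])"
    using assms nth_mor by (intro finite_mce_segments) blast+
  then show ?thesis using mce_same_length[OF assms(1,2) refl True] fin by simp
next
  case False
  then show ?thesis using mce_longer[OF assms(1,2) refl] assms(3) by simp
qed

theorem hybrid_finitely_aligned: "finitely_aligned Z2_free_Z N2_free_N H hybrid_degree"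
  unfolding finitely_aligned_def
proof (intro ballI)
  fix \<mu> \<nu> assume "\<mu> \<in> mor H" "\<nu> \<in> mor H"
  then show "finite (mce \<mu> \<nu>)"
    using finite_mce MCE_commute nat_le_linear by metis
qed

end

theorem lemma6p1:
  fixes E :: "ix \<Rightarrow> ('v, 'e) pre_digraph" and F :: "ix \<Rightarrow> ('w, 'f) pre_digraph"
    and v :: "ix \<Rightarrow> 'v" and w :: "ix \<Rightarrow> 'w"
  assumes "\<And>i. wf_digraph (E i)" and "\<And>i. wf_digraph (F i)"
    and "\<And>i. countable (verts (E i))" and "\<And>i. countable (arcs (E i))"
    and "\<And>i. countable (verts (F i))" and "\<And>i. countable (arcs (F i))"
    and "\<And>i. strongly_connected (E i)" and "\<And>i. strongly_connected (F i)"
    and "\<And>i. infinite_receiver (E i) (v i)" and "\<And>i. infinite_receiver (F i) (w i)"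
  shows "P_graph Z2_free_Z N2_free_N (hybrid E F v w) hybrid_degree \<and>
    (\<forall>\<mu> \<in> mor (hybrid E F v w). \<forall>\<nu> \<in> mor (hybrid E F v w). \<forall>m n.
       m = length \<mu> \<and> n = length \<nu> \<and> m \<le> n \<longrightarrow>
       hybrid_MCE E F v w \<mu> \<nu> =
         (if n > m \<and> (\<forall>i < m - 1. \<mu> ! i = \<nu> ! i) \<and>
             (\<exists>\<nu>' \<in> mor (hybrid E F v w).
                src (hybrid E F v w) [\<mu> ! (m - 1)] = rng (hybrid E F v w) \<nu>' \<and>
                [\<nu> ! (m - 1)] = cmp (hybrid E F v w) [\<mu> ! (m - 1)] \<nu>')
          then {\<nu>}
          else if n = m \<and> (\<forall>i < m - 1. \<mu> ! i = \<nu> ! i)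
          then left_mult (hybrid E F v w) (init_path E F v w \<mu>)
                 (hybrid_MCE E F v w [\<mu> ! (m - 1)] [\<nu> ! (m - 1)])
          else {})) \<and>
    finitely_aligned Z2_free_Z N2_free_N (hybrid E F v w) hybrid_degree"
proof -
  interpret hybrid_graph E F v w
    using assms unfolding infinite_receiver_def by (intro hybrid_graph.intro) blast+
  show ?thesis
  proof (intro conjI ballI allI impI)
    show "P_graph Z2_free_Z N2_free_N H hybrid_degree" by (rule hybrid_P_graph)
    show "finitely_aligned Z2_free_Z N2_free_N H hybrid_degree" by (rule hybrid_finitely_aligned)
    fix \<mu> \<nu> and m n :: nat
    assume *: "\<mu> \<in> mor H" "\<nu> \<in> mor H" and mn: "m = length \<mu> \<and> n = length \<nu> \<and> m \<le> n"
    show "hybrid_MCE E F v w \<mu> \<nu> =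
         (if n > m \<and> (\<forall>i < m - 1. \<mu> ! i = \<nu> ! i) \<and>
             (\<exists>\<nu>' \<in> mor H. src H [\<mu> ! (m - 1)] = rng H \<nu>' \<and> [\<nu> ! (m - 1)] = cmp H [\<mu> ! (m - 1)] \<nu>')
          then {\<nu>}
          else if n = m \<and> (\<forall>i < m - 1. \<mu> ! i = \<nu> ! i)
          then left_mult H (init_path E F v w \<mu>)
                 (hybrid_MCE E F v w [\<mu> ! (m - 1)] [\<nu> ! (m - 1)])
          else {})"
    proof (cases "n = m")
      case True
      then have "m = length \<mu>" "m = length \<nu>" using mn by auto
      note eq = mce_same_length[OF * this]
      show ?thesis unfolding hybrid_MCE_def eq True by simp
    next
      case False
      then have "m = length \<mu>" "m < length \<nu>" "m < n" using mn by auto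
      note eq = mce_longer[OF * this(1,2)]
      show ?thesis unfolding hybrid_MCE_def eq using False \<open>m < n\<close> by simp
    qed
  qed
qed

end
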